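(* Let $P$ be an $R$-labeled poset of rank $n$ with fixed $R$-labeling $\lambda$. For all $T\subseteq\{0,\dots,n-1\}$ and $\ell\ge 0$, \[ [y^\ell\cdot\mathsf{u}_T]\ {\text{ex}}\Psi(P;y,\mathbf{a},\mathbf{b})=\#\mathsf{B}_\ell(T), \] where $\mathsf{u}_T=w_0\cdots w_{n-1}$ with $w_i=\mathbf{b}$ if $i\in T$ and $w_i=\mathbf{a}$ if $i\notin T$.
   Context: A graded poset $P$ of rank $n$ is a finite poset with unique minimum $\hat 0$ (rank $0$) and unique maximum $\hat 1$ (rank $n$) such that ${\sf rank}(X)$ equals the length of every maximal chain from $\hat 0$ to $X$. A chain is a (possibly empty) totally ordered subset; ${\sf Rank}(\mathcal{C})=\{{\sf rank}(\mathcal{C}_i)\}$. For a graded poset $Q$ with minimum $\hat 0_Q$ and Möbius function $\mu$, $\mathrm{Poin}(Q;y)=\sum_{X\in Q}|\mu(\hat 0_Q,X)|\,y^{{\sf rank}_Q(X)}$; for a chain $\mathcal{C}=\{\mathcal{C}_1<\dots<\mathcal{C}_k\}$, $\mathrm{Poin}_{\mathcal{C}}(P;y)=\prod_{i=1}^k\mathrm{Poin}([\mathcal{C}_i,\mathcal{C}_{i+1}];y)$ with $\mathcal{C}_{k+1}=\hat 1$. The extended $\mathbf{a}\mathbf{b}$-index is ${\text{ex}}\Psi(P;y,\mathbf{a},\mathbf{b})=\sum_{\mathcal{C}}\mathrm{Poin}_{\mathcal{C}}(P;y){\sf wt}_{\mathcal{C}}(\mathbf{a},\mathbf{b})$ over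 chains $\mathcal{C}$ in $P\setminus\{\hat 1\}$, with noncommuting $\mathbf{a},\mathbf{b}$ and ${\sf wt}_{\mathcal{C}}=w_0\cdots w_{n-1}$, $w_i=\mathbf{b}$ if $i\in{\sf Rank}(\mathcal{C})$, else $\mathbf{a}-\mathbf{b}$. An $R$-labeling is a map $\lambda$ from cover relations to positive integers such that every interval has a unique maximal chain with weakly increasing labels; $P$ is $R$-labeled if finite, graded and admitting one. A multichain $\mathcal{D}=\{\{\mathcal{D}_1\le\dots\le\mathcal{D}_k\}\}$ interlaces $\mathcal{C}$ if $\mathcal{C}_1\le\mathcal{D}_1\le\mathcal{C}_2\le\dots\le\mathcal{C}_k\le\mathcal{D}_k$; $\mathsf{irank}(\mathcal{C},\mathcal{D})=\sum_i{\sf rank}(\mathcal{D}_i)-\sum_i{\sf rank}(\mathcal{C}_i)$. A maximal chain $\mathcal{M}=\{\mathcal{M}_0\lessdot\dots\lessdot\mathcal{M}_n\}$ decreases along $[\mathcal{M}_i,\mathcal{M}_j]$ if $\lambda(\mathcal{M}_i,\mathcal{M}_{i+1})>\dots>\lambda(\mathcal{M}_{j-1},\mathcal{M}_j)$, and weakly increases along it if these are weakly increasing. $\mathsf{IncDec}(\mathcal{C},\mathcal{D})$: maximal chains containing all $\mathcal{C}_i,\mathcal{D}_i$, decreasing along each $[\mathcal{C}_i,\mathcal{D}_i]$ and weakly increasing along $[\hat 0,\mathcal{C}_1]$, each $[\mathcal{D}_i,\mathcal{C}_{i+1}]$ and $[\mathcal{D}_k,\hat 1]$. For $S\subseteq\{0,\dots,n-1\}$,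 $\mathsf{A}_\ell(S)$ is the set of triples $(\mathcal{C},\mathcal{D},\mathcal{M})$ with $\mathcal{D}$ interlacing $\mathcal{C}$, ${\sf Rank}(\mathcal{C})=S$, $\mathsf{irank}(\mathcal{C},\mathcal{D})=\ell$, $\mathcal{M}\in\mathsf{IncDec}(\mathcal{C},\mathcal{D})$. For $S\subseteq T$, $\varphi_{S,T}(\mathcal{C},\mathcal{D},\mathcal{M})=(\mathcal{C}\cup\{\mathcal{M}_r:r\in T\setminus S\},\mathcal{D}\sqcup\{\{\mathcal{M}_r:r\in T\setminus S\}\},\mathcal{M})$, an injection $\mathsf{A}_\ell(S)\to\mathsf{A}_\ell(T)$. $\mathsf{B}_\ell(T)=\mathsf{A}_\ell(T)\setminus\bigcup_{S\subsetneq T}\varphi_{S,T}(\mathsf{A}_\ell(S))$. *)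

theory Defs
  imports
    "HOL-Library.Poly_Mapping"
    "HOL-Library.Multiset"
    "HOL-Computational_Algebra.Polynomial"
begin

section \<open>Finite graded posets\<close>

text \<open>
  A poset is a set \<open>P :: 'a::order set\<close> with the order induced from its ambient type, so that the
  intervals of \<open>P\<close> are posets of the same kind.  Chains and maximal chains are those of
  \<^theory>\<open>HOL.Zorn\<close>.
\<close>

abbreviation is_chain :: "'a::order set \<Rightarrow> 'a set \<Rightarrow> bool" where
  "is_chain P \<equiv> pred_on.chain P (\<le>)"

abbreviation is_maxchain :: "'a::order set \<Rightarrow> 'a set \<Rightarrow> bool" where
  "is_maxchain P \<equiv> pred_on.maxchain P (\<le>)"

definition pbot :: "'a::order set \<Rightarrow> 'a" where
  "pbot P = (LEAST x. x \<in> P)"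

definition ptop :: "'a::order set \<Rightarrow> 'a" where
  "ptop P = (GREATEST x. x \<in> P)"

definition ival :: "'a::order set \<Rightarrow> 'a \<Rightarrow> 'a \<Rightarrow> 'a set" where
  "ival P X Y = {Z \<in> P. X \<le> Z \<and> Z \<le> Y}"

text \<open>
  The length of a chain with \<open>r + 1\<close> elements is \<open>r\<close>.  The description below is meaningful only if
  all maximal chains of \<open>[pbot P, X]\<close> have the same length.
\<close>
definition prank :: "'a::order set \<Rightarrow> 'a \<Rightarrow> nat" where
  "prank P X = (THE r. \<forall>C. is_maxchain (ival P (pbot P) X) C \<longrightarrow> card C = Suc r)"

definition graded_poset :: "'a::order set \<Rightarrow> nat \<Rightarrow> bool" where
  "graded_poset P n \<longleftrightarrow>
     finite P \<and>
     (\<exists>x\<in>P. \<forall>y\<in>P. x \<le> y) \<and>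
     (\<exists>x\<in>P. \<forall>y\<in>P. y \<le> x) \<and>
     (\<forall>X\<in>P. \<forall>C. is_maxchain (ival P (pbot P) X) C \<longrightarrow> card C = Suc (prank P X)) \<and>
     prank P (ptop P) = n"

text \<open>
  The elements of a finite (multi)chain in increasing order; the \<open>i\<close>-th element of the informal
  notation, counted from 1, is the entry \<open>i - 1\<close> of the list.  For a maximal chain
  \<open>M\<^sub>0 \<lessdot> \<dots> \<lessdot> M\<^sub>n\<close>, counted from 0, \<open>M\<^sub>r\<close> is entry \<open>r\<close>.
\<close>
definition mchain_list :: "'a::order multiset \<Rightarrow> 'a list" where
  "mchain_list D = (THE xs. sorted_wrt (\<le>) xs \<and> mset xs = D)"

definition chain_list :: "'a::order set \<Rightarrow> 'a list" where
  "chain_list C = mchain_list (mset_set C)"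


section \<open>Poincare polynomials\<close>

function moebius :: "'a::order set \<Rightarrow> 'a \<Rightarrow> 'a \<Rightarrow> int" where
  "moebius Q X Y =
     (if finite Q \<and> X \<in> Q \<and> Y \<in> Q \<and> X \<le> Y
      then if X = Y then 1 else - (\<Sum>Z\<in>{Z \<in> Q. X \<le> Z \<and> Z < Y}. moebius Q X Z)
      else 0)"
  by pat_completeness auto
termination
proof (relation "measure (\<lambda>(Q, X, Y). card {Z \<in> Q. Z < Y})", goal_cases)
  case (2 Q X Y Z)
  then have "{W \<in> Q. W < Z} \<subset> {W \<in> Q. W < Y}"
    by auto
  with 2 show ?case
    by (auto intro: psubset_card_mono)
qed auto

declare moebius.simps [simp del]

definition Poin :: "'a::order set \<Rightarrow> int poly" where
  "Poin Q = (\<Sum>X\<in>Q. monom \<bar>moebius Q (pbot Q) X\<bar> (prank Q X))"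

definition Poin_chain :: "'a::order set \<Rightarrow> 'a set \<Rightarrow> int poly" where
  "Poin_chain P C =
     (let cs = chain_list C @ [ptop P] in \<Prod>i<card C. Poin (ival P (cs ! i) (cs ! Suc i)))"


section \<open>The extended ab-index\<close>

text \<open>
  Noncommutative polynomials in \<open>a\<close>, \<open>b\<close> over \<open>\<int>[y]\<close> form the monoid algebra of the free monoid of
  words.  \<^theory>\<open>HOL-Library.Poly_Mapping\<close> takes the monoid additively, so concatenation is
  written \<open>+\<close>.
\<close>

datatype letter = Letter_a | Letter_b

datatype word = Word "letter list"

instantiation word :: monoid_add
begin

definition zero_word :: word where
  "zero_word = Word []"

fun plus_word :: "word \<Rightarrow> word \<Rightarrow> word" where
  "plus_word (Word u) (Word v) = Word (u @ v)"

instance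
proof
  fix u v w :: word
  show "u + v + w = u + (v + w)"
    by (cases u; cases v; cases w) simp
  show "0 + u = u" "u + 0 = u"
    by (cases u; simp add: zero_word_def)+
qed

end

type_synonym ab_poly = "word \<Rightarrow>\<^sub>0 int poly"

definition var_a :: ab_poly where
  "var_a = Poly_Mapping.single (Word [Letter_a]) 1"

definition var_b :: ab_poly where
  "var_b = Poly_Mapping.single (Word [Letter_b]) 1"

definition scalar :: "int poly \<Rightarrow> ab_poly" where
  "scalar p = Poly_Mapping.single 0 p"

definition wt :: "'a::order set \<Rightarrow> 'a set \<Rightarrow> ab_poly" where
  "wt P C = prod_list (map (\<lambda>i. if i \<in> prank P ` C then var_b else var_a - var_b)
                           [0..<prank P (ptop P)])"

definition exPsi :: "'a::order set \<Rightarrow> ab_poly" where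
  "exPsi P = (\<Sum>C | is_chain (P - {ptop P}) C. scalar (Poin_chain P C) * wt P C)"

definition u_word :: "nat \<Rightarrow> nat set \<Rightarrow> word" where
  "u_word n T = Word (map (\<lambda>i. if i \<in> T then Letter_b else Letter_a) [0..<n])"

lemma prod_list_vars_eq_single_u_word:
  "prod_list (map (\<lambda>i. if i \<in> T then var_b else var_a) [0..<n]) = Poly_Mapping.single (u_word n T) 1"
  by (induction n)
     (auto simp: u_word_def var_a_def var_b_def Poly_Mapping.mult_single
           simp flip: zero_word_def Poly_Mapping.single_one)

text \<open>The coefficient of \<open>y\<^sup>l w\<close>, for a word \<open>w\<close> in \<open>a\<close>, \<open>b\<close>.\<close>
definition yw_coeff :: "ab_poly \<Rightarrow> nat \<Rightarrow> word \<Rightarrow> int" where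
  "yw_coeff f l w = coeff (Poly_Mapping.lookup f w) l"


section \<open>R-labelings\<close>

definition covers :: "'a::order set \<Rightarrow> 'a \<Rightarrow> 'a \<Rightarrow> bool" where
  "covers P X Y \<longleftrightarrow> X \<in> P \<and> Y \<in> P \<and> X < Y \<and> \<not> (\<exists>Z\<in>P. X < Z \<and> Z < Y)"

definition labels :: "('a::order \<Rightarrow> 'a \<Rightarrow> nat) \<Rightarrow> 'a set \<Rightarrow> nat list" where
  "labels lam M = (let xs = chain_list M in map2 lam xs (tl xs))"

text \<open>Only the values of \<open>lam\<close> on cover relations of \<open>P\<close> matter.\<close>
definition R_labeling :: "'a::order set \<Rightarrow> ('a \<Rightarrow> 'a \<Rightarrow> nat) \<Rightarrow> bool" where
  "R_labeling P lam \<longleftrightarrow>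
     (\<forall>X Y. covers P X Y \<longrightarrow> 0 < lam X Y) \<and>
     (\<forall>X\<in>P. \<forall>Y\<in>P. X \<le> Y \<longrightarrow>
        (\<exists>!M. is_maxchain (ival P X Y) M \<and> sorted_wrt (\<le>) (labels lam M)))"


section \<open>Interlacing multichains and the sets A and B\<close>

definition is_multichain :: "'a::order set \<Rightarrow> 'a multiset \<Rightarrow> bool" where
  "is_multichain P D \<longleftrightarrow> is_chain P (set_mset D)"

definition interlaces :: "'a::order multiset \<Rightarrow> 'a set \<Rightarrow> bool" where
  "interlaces D C \<longleftrightarrow>
     size D = card C \<and>
     (\<forall>i<card C. chain_list C ! i \<le> mchain_list D ! i) \<and>
     (\<forall>i. Suc i < card C \<longrightarrow> mchain_list D ! i \<le> chain_list C ! Suc i)"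

definition irank :: "'a::order set \<Rightarrow> 'a set \<Rightarrow> 'a multiset \<Rightarrow> int" where
  "irank P C D = int (\<Sum>X\<in>#D. prank P X) - int (\<Sum>X\<in>C. prank P X)"

text \<open>For a maximal chain \<open>M\<close> through \<open>X \<le> Y\<close>, the part of \<open>M\<close> inside \<open>[X, Y]\<close> is \<open>M \<inter> {X..Y}\<close>.\<close>
definition decreasing_along :: "('a::order \<Rightarrow> 'a \<Rightarrow> nat) \<Rightarrow> 'a set \<Rightarrow> 'a \<Rightarrow> 'a \<Rightarrow> bool" where
  "decreasing_along lam M X Y \<longleftrightarrow> sorted_wrt (>) (labels lam (M \<inter> {X..Y}))"

definition weakly_increasing_along :: "('a::order \<Rightarrow> 'a \<Rightarrow> nat) \<Rightarrow> 'a set \<Rightarrow> 'a \<Rightarrow> 'a \<Rightarrow> bool" where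
  "weakly_increasing_along lam M X Y \<longleftrightarrow> sorted_wrt (\<le>) (labels lam (M \<inter> {X..Y}))"

text \<open>
  With the conventions \<open>D\<^sub>0 = pbot P\<close> and \<open>C\<^bsub>k+1\<^esub> = ptop P\<close>, the weakly increasing segments are
  \<open>[D\<^sub>i, C\<^bsub>i+1\<^esub>]\<close> for \<open>0 \<le> i \<le> k\<close>; if \<open>k = 0\<close>, the only one is \<open>[pbot P, ptop P]\<close>.
\<close>
definition IncDec ::
    "'a::order set \<Rightarrow> ('a \<Rightarrow> 'a \<Rightarrow> nat) \<Rightarrow> 'a set \<Rightarrow> 'a multiset \<Rightarrow> 'a set set" where
  "IncDec P lam C D =
     {M. is_maxchain P M \<and> C \<subseteq> M \<and> set_mset D \<subseteq> M \<and>
         (\<forall>i<card C. decreasing_along lam M (chain_list C ! i) (mchain_list D ! i)) \<and>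
         (\<forall>i\<le>card C. weakly_increasing_along lam M
            ((pbot P # mchain_list D) ! i) ((chain_list C @ [ptop P]) ! i))}"

definition A_set ::
    "'a::order set \<Rightarrow> ('a \<Rightarrow> 'a \<Rightarrow> nat) \<Rightarrow> nat \<Rightarrow> nat set \<Rightarrow> ('a set \<times> 'a multiset \<times> 'a set) set" where
  "A_set P lam l S =
     {(C, D, M). is_chain P C \<and> is_multichain P D \<and> interlaces D C \<and>
                 prank P ` C = S \<and> irank P C D = int l \<and> M \<in> IncDec P lam C D}"

definition phi ::
    "nat set \<Rightarrow> nat set \<Rightarrow> 'a::order set \<times> 'a multiset \<times> 'a set \<Rightarrow> 'a set \<times> 'a multiset \<times> 'a set" where
  "phi S T = (\<lambda>(C, D, M).
     let N = (\<lambda>r. chain_list M ! r) ` (T - S) in (C \<union> N, D + mset_set N, M))"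

definition B_set ::
    "'a::order set \<Rightarrow> ('a \<Rightarrow> 'a \<Rightarrow> nat) \<Rightarrow> nat \<Rightarrow> nat set \<Rightarrow> ('a set \<times> 'a multiset \<times> 'a set) set" where
  "B_set P lam l T = A_set P lam l T - (\<Union>S\<in>{S. S \<subset> T}. phi S T ` A_set P lam l S)"

end

theory Submission
  imports Defs
begin

text \<open>
  For a triple \<open>(\<C>, \<D>, \<M>)\<close> in \<open>A_set\<close>, mark the edges of \<open>\<M>\<close> lying in some \<open>[\<C>\<^sub>i, \<D>\<^sub>i]\<close>.
  With \<open>E\<close> the set of bottom ranks of the marked edges, the ranks of \<open>\<D>\<close> form the multiset
  \<open>Rank \<C> + Suc ` E - E\<close>, so that \<open>irank\<close> is \<open>|E|\<close> and a triple with \<open>Rank \<C> = S\<close> is the same as a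
  marked maximal chain satisfying a local condition at every rank outside \<open>S\<close>.  The maps \<open>phi\<close>
  leave the marked chain unchanged; hence \<open>B_set\<close> at \<open>T\<close> corresponds to the marked chains violating the
  local condition exactly at the ranks in \<open>T\<close>.  On the other side, \<open>\<bar>\<mu>(X, Y)\<bar>\<close> counts the strictly
  decreasing maximal chains of \<open>[X, Y]\<close>, so \<open>Poin_chain\<close> at \<open>\<C>\<close> is the generating function, by number of
  marks, of the marked maximal chains through \<open>\<C>\<close> that violate the condition only at elements
  of \<open>\<C>\<close>.  Inclusion-exclusion over \<open>\<C>\<close> finishes the proof.
\<close>

section \<open>Chains and cover paths\<close>

text \<open>The condition at a vertex involves only its two adjacent edges. A marked run may start
  only at an element of \<open>C\<close>, descends while it lasts, and may stop anywhere without a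
  condition on labels; consecutive unmarked edges weakly increase. Vertices of \<open>C\<close> are
  exempt, so cutting there decouples the pieces and gives a product over intervals. A piece on
  \<open>[x, z]\<close> without a violation inside is a marked descending run followed by an
  unmarked weakly increasing one. The R-labeling makes the second part unique, so pieces with
  \<open>k\<close> marks correspond to descending paths of length \<open>k\<close> from
  \<open>x\<close> to some element of \<open>[x, z]\<close>, which is the coefficient of degree
  \<open>k\<close> in the Poincare polynomial. The same decomposition counted with signs proves the
  Moebius formula: on a nonempty label list, the cuts into a descending and an increasing part come
  as an adjacent pair or not at all. Below the first element of \<open>C\<close> the factor must be
  1 instead; this is the purpose of the virtual edge \<open>(0, False)\<close> entering
  \<open>p0\<close>. It lets an unmarked first edge pass with any label and turns a marked first
  edge into a violation at \<open>p0\<close>.\<close>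

lemma mchain_list_mset:
  assumes "sorted_wrt (\<le>) (xs :: 'a::order list)"
  shows "mchain_list (mset xs) = xs"
proof -
  have "ys = xs" if "sorted_wrt (\<le>) ys" "mset ys = mset xs" for ys
    using assms that
  proof (induction xs arbitrary: ys)
    case (Cons x xs)
    then obtain y zs where ys: "ys = y # zs"
      by (cases ys) auto
    have "x \<in> set ys" "y \<in> set (x # xs)"
      using Cons.prems(3) ys by (metis list.set_intros(1) set_mset_mset)+
    with Cons.prems ys have "x = y"
      by (auto intro: antisym)
    with Cons ys show ?case
      by auto
  qed auto
  with assms show ?thesis
    unfolding mchain_list_def by (intro the_equality) auto
qed

lemma chain_list_set:
  assumes "sorted_wrt (<) (xs :: 'a::order list)"
  shows "chain_list (set xs) = xs"
proof -
  have "distinct xs"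
    using assms by (induction xs) auto
  moreover have "sorted_wrt (\<le>) xs"
    using assms by (rule sorted_wrt_mono_rel[rotated]) auto
  ultimately show ?thesis
    unfolding chain_list_def by (simp add: mset_set_set mchain_list_mset)
qed

lemma is_chain_iff: "is_chain P C \<longleftrightarrow> C \<subseteq> P \<and> (\<forall>x\<in>C. \<forall>y\<in>C. x \<le> y \<or> y \<le> x)"
  unfolding pred_on.chain_def by auto

lemma sorted_less_nth_le:
  "sorted_wrt (<) (xs :: 'a::order list) \<Longrightarrow> i \<le> j \<Longrightarrow> j < length xs \<Longrightarrow> xs ! i \<le> xs ! j"
  by (cases "i = j") (auto simp: sorted_wrt_iff_nth_less order.strict_implies_order)

text \<open>The ambient type is only partially ordered, but a minimal element of a chain is its
  least element; removing it repeatedly yields the list.\<close>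

lemma finite_chain_sorted_list:
  assumes "finite C" "is_chain P (C :: 'a::order set)"
  obtains xs where "sorted_wrt (<) xs" "set xs = C"
proof -
  have "\<exists>xs. sorted_wrt (<) xs \<and> set xs = C"
    using assms
  proof (induction "card C" arbitrary: C)
    case 0
    then show ?case by (intro exI[of _ "[]"]) auto
  next
    case (Suc k)
    then have "C \<noteq> {}" by auto
    with Suc.prems obtain x where x: "x \<in> C" "\<And>y. y \<in> C \<Longrightarrow> y \<le> x \<Longrightarrow> x = y"
      using finite_has_minimal by metis
    have "is_chain P (C - {x})"
      using Suc.prems unfolding pred_on.chain_def by blast
    moreover have "k = card (C - {x})"
      using x Suc by simp
    ultimately obtain xs where xs: "sorted_wrt (<) xs" "set xs = C - {x}"
      using Suc.hyps(1)[of "C - {x}"] Suc.prems(1) by auto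
    have "x < y" if "y \<in> C - {x}" for y
      using that x Suc.prems(2) by (auto simp: is_chain_iff order.order_iff_strict)
    with xs x(1) show ?case
      by (intro exI[of _ "x # xs"]) auto
  qed
  with that show ?thesis by blast
qed

text \<open>The list leaves out the start \<open>x\<close>, so its length is the number of cover
  steps and paths are joined by plain append. The membership test in the empty case keeps every
  vertex in \<open>P\<close>.\<close>

fun cover_path :: "'a::order set \<Rightarrow> 'a \<Rightarrow> 'a list \<Rightarrow> 'a \<Rightarrow> bool" where
  "cover_path P x [] y \<longleftrightarrow> x = y \<and> x \<in> P"
| "cover_path P x (z # s) y \<longleftrightarrow> covers P x z \<and> cover_path P z s y"

lemma cover_path_append:
  "cover_path P x (s @ t) y \<longleftrightarrow> (\<exists>z. cover_path P x s z \<and> cover_path P z t y)"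
proof (induction s arbitrary: x)
  case Nil
  have "cover_path P x t y \<Longrightarrow> x \<in> P"
    by (cases t) (auto simp: covers_def)
  then show ?case by auto
qed auto

lemma cover_path_last: "cover_path P x s y \<Longrightarrow> y = last (x # s)"
  by (induction s arbitrary: x) auto

lemma cover_path_subset: "cover_path P x s y \<Longrightarrow> set (x # s) \<subseteq> P"
  by (induction s arbitrary: x) (auto simp: covers_def)

lemma cover_path_end: "cover_path P x s y \<Longrightarrow> y \<in> P"
  by (induction s arbitrary: x) auto

lemma cover_path_sorted: "cover_path P x s y \<Longrightarrow> sorted_wrt (<) (x # s)"
proof (induction s arbitrary: x)
  case (Cons z s)
  then have "x < z" "sorted_wrt (<) (z # s)"
    by (auto simp: covers_def)
  then show ?case by auto
qed auto

lemma cover_path_distinct: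
  assumes "cover_path P x s y"
  shows "distinct (x # s)"
proof -
  have "sorted_wrt (<) xs \<Longrightarrow> distinct xs" for xs :: "'a list"
    by (induction xs) auto
  then show ?thesis
    using cover_path_sorted[OF assms] .
qed

lemma cover_path_le_end: "cover_path P x s y \<Longrightarrow> v \<in> set (x # s) \<Longrightarrow> v \<le> y"
proof (induction s arbitrary: x v)
  case (Cons z s)
  then have "x < z" "z \<le> y" "v = x \<or> v \<le> y"
    by (auto simp: covers_def)
  then show ?case by auto
qed auto

lemma cover_path_ge_start: "cover_path P x s y \<Longrightarrow> v \<in> set (x # s) \<Longrightarrow> x \<le> v"
  using cover_path_sorted[of P x s y] by auto

lemma cover_path_trivial: "cover_path P x s x \<longleftrightarrow> s = [] \<and> x \<in> P"
  using cover_path_le_end[of P x s x] cover_path_sorted[of P x s x] by (cases s) force+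

text \<open>Follow the path while its vertices stay below \<open>z\<close>: the next vertex would be
  above \<open>z\<close>, and a cover step has nothing strictly between its ends, so the path cannot
  jump over \<open>z\<close>. This yields the maximality of its vertex set.\<close>

lemma cover_path_comparable:
  assumes "cover_path P x s y" "z \<in> P" "x \<le> z" "z \<le> y" "\<And>v. v \<in> set (x # s) \<Longrightarrow> v \<le> z \<or> z \<le> v"
  shows "z \<in> set (x # s)"
  using assms
proof (induction s arbitrary: x)
  case (Cons u s)
  show ?case
  proof (cases "u \<le> z")
    case True
    then show ?thesis using Cons by auto
  next
    case False
    then have "z < u" using Cons.prems(5)[of u] by auto
    then have "\<not> x < z" using Cons.prems by (auto simp: covers_def)
    then show ?thesis using Cons.prems by auto
  qed
qed auto

lemma cover_path_chain: "cover_path P x s y \<Longrightarrow> is_chain (ival P x y) (set (x # s))"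
  unfolding pred_on.chain_def
proof (intro conjI)
  assume s: "cover_path P x s y"
  show "set (x # s) \<subseteq> ival P x y"
    using cover_path_subset[OF s] cover_path_le_end[OF s] cover_path_ge_start[OF s]
    by (auto simp: ival_def)
  have *: "u = v \<or> u \<le> v \<or> v \<le> u" if "sorted_wrt (<) xs" "u \<in> set xs" "v \<in> set xs" for xs :: "'a list" and u v
    using that by (induction xs) auto
  show "\<forall>u\<in>set (x # s). \<forall>v\<in>set (x # s). sup (\<le>) (=) u v \<or> sup (\<le>) (=) v u"
    using *[OF cover_path_sorted[OF s]] by auto
qed

lemma cover_path_maxchain: "cover_path P x s y \<Longrightarrow> is_maxchain (ival P x y) (set (x # s))"
proof -
  assume s: "cover_path P x s y"
  have False if S: "is_chain (ival P x y) S" "set (x # s) \<subset> S" for S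
  proof -
    from S obtain z where z: "z \<in> S" "z \<notin> set (x # s)" by blast
    have "z \<in> ival P x y" using S z by (auto simp: pred_on.chain_def)
    moreover have "v \<le> z \<or> z \<le> v" if "v \<in> set (x # s)" for v
      using S z that unfolding pred_on.chain_def by blast
    ultimately show False
      using cover_path_comparable[OF s, of z] z by (auto simp: ival_def)
  qed
  then show ?thesis
    using cover_path_chain[OF s] by (auto simp: pred_on.maxchain_def)
qed

lemma cover_path_if_successively:
  "successively (covers P) (x # s) \<Longrightarrow> x \<in> P \<Longrightarrow> cover_path P x s (last (x # s))"
  by (induction s arbitrary: x) (auto simp: covers_def)

text \<open>By maximality, anything in the interval that is comparable with all of \<open>M\<close>
  belongs to \<open>M\<close> (fact \<open>add\<close>). Applied to \<open>x\<close> and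
  \<open>y\<close> this fixes the ends; applied to a point between two consecutive entries it shows
  that they form a cover.\<close>

lemma maxchain_cover_path:
  assumes "finite P" "x \<in> P" "y \<in> P" "x \<le> y" "is_maxchain (ival P x y) M"
  obtains s where "cover_path P x s y" "M = set (x # s)"
proof -
  have ch: "is_chain (ival P x y) M" and mx: "\<And>S. is_chain (ival P x y) S \<Longrightarrow> M \<subseteq> S \<Longrightarrow> S = M"
    using assms(5) by (auto simp: pred_on.maxchain_def)
  have sub: "M \<subseteq> ival P x y"
    using ch by (auto simp: pred_on.chain_def)
  have add: "z \<in> M" if "z \<in> ival P x y" "\<And>v. v \<in> M \<Longrightarrow> v \<le> z \<or> z \<le> v" for z
  proof -
    have "is_chain (ival P x y) (insert z M)"
      using ch that by (auto simp: pred_on.chain_def)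
    then show ?thesis using mx by blast
  qed
  have xM: "x \<in> M" and yM: "y \<in> M"
    using add[of x] add[of y] sub assms by (auto simp: ival_def)
  have "finite M"
    using sub assms(1) by (auto simp: ival_def intro: finite_subset)
  then obtain xs where xs: "sorted_wrt (<) xs" "set xs = M"
    using finite_chain_sorted_list ch by blast
  with xM obtain h s where hs: "xs = h # s" by (cases xs) auto
  have "h \<le> x" using xM xs hs by auto
  moreover have "x \<le> h" using xs hs sub by (auto simp: ival_def)
  ultimately have h: "h = x" by simp
  have "successively (covers P) xs"
  proof -
    have "covers P (xs ! i) (xs ! Suc i)" if i: "Suc i < length xs" for i
    proof -
      have mem: "xs ! i \<in> M" "xs ! Suc i \<in> M" using i xs by auto
      have "False" if w: "w \<in> P" "xs ! i < w" "w < xs ! Suc i" for w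
      proof -
        have wi: "w \<in> ival P x y"
          using w mem sub by (fastforce simp: ival_def)
        have "v \<le> w \<or> w \<le> v" if "v \<in> M" for v
        proof -
          from that obtain j where j: "j < length xs" "v = xs ! j"
            using xs by (auto simp: in_set_conv_nth)
          have "v \<le> xs ! i \<or> xs ! Suc i \<le> v"
            using j i sorted_less_nth_le[OF xs(1), of j i] sorted_less_nth_le[OF xs(1), of "Suc i" j]
            by (cases "j \<le> i") auto
          then show ?thesis
            using w(2,3) by (meson order.strict_implies_order order.trans)
        qed
        then have "w \<in> M" using add wi by blast
        then obtain j where j: "j < length xs" "w = xs ! j"
          using xs by (auto simp: in_set_conv_nth)
        consider "j \<le> i" | "Suc i \<le> j" by linarith
        then show False
          using j i w sorted_less_nth_le[OF xs(1), of j i] sorted_less_nth_le[OF xs(1), of "Suc i" j]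
          by cases auto
      qed
      then show ?thesis
        using mem sub i xs(1) by (auto simp: covers_def ival_def sorted_wrt_iff_nth_less)
    qed
    then show ?thesis by (simp add: successively_conv_nth)
  qed
  then have s: "cover_path P x s (last (x # s))"
    using cover_path_if_successively assms(2) hs h by blast
  have "last (x # s) \<in> M" using xs hs h by (metis last_in_set list.distinct(1))
  then have "last (x # s) \<le> y" using sub by (auto simp: ival_def)
  moreover have "y \<le> last (x # s)"
    using cover_path_le_end[OF s] yM xs hs h by blast
  ultimately have "cover_path P x s y" using s by simp
  with that xs hs h show ?thesis by blast
qed

lemma chain_list_cover_path: "cover_path P x s y \<Longrightarrow> chain_list (set (x # s)) = x # s"
  using chain_list_set cover_path_sorted by blast

fun edge_labels :: "('a \<Rightarrow> 'a \<Rightarrow> 'b) \<Rightarrow> 'a \<Rightarrow> 'a list \<Rightarrow> 'b list" where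
  "edge_labels lam x [] = []"
| "edge_labels lam x (z # s) = lam x z # edge_labels lam z s"

lemma length_edge_labels [simp]: "length (edge_labels lam x s) = length s"
  by (induction s arbitrary: x) auto

lemma edge_labels_eq_Nil_iff: "edge_labels lam x s = [] \<longleftrightarrow> s = []"
  by (cases s) auto

lemma edge_labels_append:
  "edge_labels lam x (s @ t) = edge_labels lam x s @ edge_labels lam (last (x # s)) t"
  by (induction s arbitrary: x) auto

lemma map2_tl_edge_labels: "map2 lam (x # s) s = edge_labels lam x s"
  by (induction s arbitrary: x) auto

lemma labels_cover_path: "cover_path P x s y \<Longrightarrow> labels lam (set (x # s)) = edge_labels lam x s"
  using chain_list_cover_path[of P x s y] map2_tl_edge_labels[of lam x s]
  by (simp add: labels_def Let_def)

section \<open>Moebius function and descending paths\<close>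

text \<open>If \<open>l # ls\<close> has a cut of the required kind, it descends to a turning entry
  and increases from there on, and exactly the cuts just before and just after that entry qualify.
  They cancel. As \<open>l\<close> is forced into the prefix, one cut of the pair is lost precisely
  when \<open>l\<close> itself is the turning entry, that is, when the whole list increases.\<close>

lemma alternating_sum_dec_inc_Cons:
  fixes l :: "'b::linorder"
  shows "(\<Sum>j\<le>length ls. (-1) ^ j * of_bool (sorted_wrt (>) (l # take j ls) \<and> sorted_wrt (\<le>) (drop j ls)))
    = (of_bool (sorted_wrt (\<le>) (l # ls)) :: int)"
proof (induction ls arbitrary: l)
  case (Cons x ls)
  have gt: "sorted_wrt (>) (l # x # ys) \<longleftrightarrow> l > x \<and> sorted_wrt (>) (x # ys)" for ys
    by auto
  have "(\<Sum>j\<le>length (x # ls). (-1) ^ j * of_bool (sorted_wrt (>) (l # take j (x # ls)) \<and> sorted_wrt (\<le>) (drop j (x # ls))))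
    = of_bool (sorted_wrt (\<le>) (x # ls))
      + (\<Sum>j\<le>length ls. - of_bool (l > x) * ((-1) ^ j * of_bool (sorted_wrt (>) (x # take j ls) \<and> sorted_wrt (\<le>) (drop j ls)) :: int))"
    unfolding list.size(4) add_Suc_right add_0_right sum.atMost_Suc_shift
    by (intro arg_cong2[where f = "(+)"] sum.cong) (simp_all only: take_Suc_Cons drop_Suc_Cons gt, auto)
  also have "\<dots> = of_bool (sorted_wrt (\<le>) (x # ls)) - of_bool (l > x) * of_bool (sorted_wrt (\<le>) (x # ls))"
    unfolding sum_distrib_left[symmetric] Cons.IH by simp
  also have "\<dots> = of_bool (sorted_wrt (\<le>) (l # x # ls))"
    unfolding sorted2 by auto
  finally show ?case .
qed auto

lemma alternating_sum_dec_inc: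
  fixes ls :: "'b::linorder list"
  shows "(\<Sum>j\<le>length ls. (-1) ^ j * of_bool (sorted_wrt (>) (take j ls) \<and> sorted_wrt (\<le>) (drop j ls)))
    = (of_bool (ls = []) :: int)"
proof (cases ls)
  case (Cons x xs)
  have "(\<Sum>j\<le>length ls. (-1) ^ j * of_bool (sorted_wrt (>) (take j ls) \<and> sorted_wrt (\<le>) (drop j ls)))
    = of_bool (sorted_wrt (\<le>) (x # xs))
      - (\<Sum>j\<le>length xs. (-1) ^ j * of_bool (sorted_wrt (>) (x # take j xs) \<and> sorted_wrt (\<le>) (drop j xs)) :: int)"
    unfolding Cons list.size(4) add_Suc_right add_0_right sum.atMost_Suc_shift
    by (simp add: sum_negf)
  then show ?thesis
    unfolding alternating_sum_dec_inc_Cons using Cons by simp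
qed auto

section \<open>Ranks, intervals and the Moebius function of an R-labeled poset\<close>

locale R_labeled_poset =
  fixes P :: "'a::order set" and n :: nat and lam :: "'a \<Rightarrow> 'a \<Rightarrow> nat"
  assumes graded: "graded_poset P n"
    and R_labeling: "R_labeling P lam"
begin

abbreviation "p0 \<equiv> pbot P"
abbreviation "p1 \<equiv> ptop P"
abbreviation "rk \<equiv> prank P"
abbreviation "elabels \<equiv> edge_labels lam"

lemma finite_P: "finite P"
  using graded by (simp add: graded_poset_def)

lemma bot: "p0 \<in> P" "x \<in> P \<Longrightarrow> p0 \<le> x"
proof -
  obtain m where m: "m \<in> P" "\<And>y. y \<in> P \<Longrightarrow> m \<le> y"
    using graded by (auto simp: graded_poset_def)
  then have "p0 = m"
    unfolding pbot_def by (intro Least_equality) auto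
  with m show "p0 \<in> P" "x \<in> P \<Longrightarrow> p0 \<le> x" by auto
qed

lemma top: "p1 \<in> P" "x \<in> P \<Longrightarrow> x \<le> p1"
proof -
  obtain m where m: "m \<in> P" "\<And>y. y \<in> P \<Longrightarrow> y \<le> m"
    using graded by (auto simp: graded_poset_def)
  then have "p1 = m"
    unfolding ptop_def by (intro Greatest_equality) auto
  with m show "p1 \<in> P" "x \<in> P \<Longrightarrow> x \<le> p1" by auto
qed

lemma unique_increasing_path:
  assumes "x \<in> P" "y \<in> P" "x \<le> y"
  shows "\<exists>!s. cover_path P x s y \<and> sorted_wrt (\<le>) (elabels x s)"
proof -
  obtain M where M: "is_maxchain (ival P x y) M" "sorted_wrt (\<le>) (labels lam M)"
    and uniq: "\<And>M'. is_maxchain (ival P x y) M' \<Longrightarrow> sorted_wrt (\<le>) (labels lam M') \<Longrightarrow> M' = M"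
    using R_labeling assms unfolding R_labeling_def by metis
  obtain s where s: "cover_path P x s y" "M = set (x # s)"
    using maxchain_cover_path[OF finite_P assms M(1)] .
  have "t = s" if t: "cover_path P x t y" "sorted_wrt (\<le>) (elabels x t)" for t
  proof -
    have "set (x # t) = M"
      using uniq[OF cover_path_maxchain[OF t(1)]] labels_cover_path[OF t(1), of lam] t(2) by simp
    then have "x # t = x # s"
      using chain_list_cover_path s t(1) by metis
    then show ?thesis by simp
  qed
  moreover have "sorted_wrt (\<le>) (elabels x s)"
    using labels_cover_path[OF s(1), of lam] M(2) s(2) by simp
  ultimately show ?thesis using s(1) by blast
qed

lemma length_path_from_bot:
  assumes s: "cover_path P p0 s x"
  shows "length s = rk x"
proof -
  have "x \<in> P" using cover_path_end[OF s] .
  then have "card (set (p0 # s)) = Suc (rk x)"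
    using graded cover_path_maxchain[OF s] unfolding graded_poset_def by blast
  moreover have "distinct (p0 # s)"
    using cover_path_distinct[OF s] .
  ultimately show ?thesis
    using distinct_card by fastforce
qed

lemma rk_path:
  assumes s: "cover_path P x s y"
  shows "rk y = rk x + length s"
proof -
  have "x \<in> P" using cover_path_subset[OF s] by simp
  then obtain t where t: "cover_path P p0 t x"
    using unique_increasing_path[OF bot(1)] bot(2) by blast
  with s have "cover_path P p0 (t @ s) y"
    by (auto simp: cover_path_append)
  from length_path_from_bot[OF this] length_path_from_bot[OF t] show ?thesis by simp
qed

lemma rk_top: "rk p1 = n"
  using graded by (simp add: graded_poset_def)

lemma finite_paths: "finite {s. cover_path P x s y}"
proof (rule finite_subset)
  show "{s. cover_path P x s y} \<subseteq> {s. set s \<subseteq> P \<and> length s = rk y - rk x}"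
    using cover_path_subset rk_path by fastforce
  show "finite {s. set s \<subseteq> P \<and> length s = rk y - rk x}"
    using finite_lists_length_eq[OF finite_P] .
qed

lemma ex_path:
  assumes "x \<in> P" "y \<in> P" "x \<le> y"
  obtains s where "cover_path P x s y"
  using unique_increasing_path[OF assms] by blast

lemma rk_mono: "x \<in> P \<Longrightarrow> y \<in> P \<Longrightarrow> x \<le> y \<Longrightarrow> rk x \<le> rk y"
  using ex_path rk_path by (metis le_add1)

lemma rk_strict_mono: "x \<in> P \<Longrightarrow> y \<in> P \<Longrightarrow> x < y \<Longrightarrow> rk x < rk y"
proof -
  assume *: "x \<in> P" "y \<in> P" "x < y"
  then obtain s where s: "cover_path P x s y" using ex_path by (metis order.strict_implies_order)
  with * have "s \<noteq> []" by auto
  with rk_path[OF s] show ?thesis by simp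
qed

lemma pbot_ival: "x \<in> P \<Longrightarrow> x \<le> y \<Longrightarrow> pbot (ival P x y) = x"
  unfolding pbot_def by (intro Least_equality) (auto simp: ival_def)

text \<open>\<open>prank\<close> is a definite description over all maximal chains of
  \<open>[x, z]\<close>. Their common length comes from additivity of rank along paths; for
  uniqueness at least one such chain must exist, and \<open>ex_path\<close> provides it.\<close>

lemma prank_ival:
  assumes "x \<in> P" "z \<in> ival P x y"
  shows "prank (ival P x y) z = rk z - rk x"
proof -
  have z: "z \<in> P" "x \<le> z" "z \<le> y" using assms by (auto simp: ival_def)
  have eq: "ival (ival P x y) (pbot (ival P x y)) z = ival P x z"
    using assms z pbot_ival[of x y] by (auto simp: ival_def)
  have card: "card C = Suc (rk z - rk x)" if C: "is_maxchain (ival P x z) C" for C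
  proof -
    obtain s where s: "cover_path P x s z" "C = set (x # s)"
      using maxchain_cover_path[OF finite_P assms(1) z(1,2) C] .
    have "distinct (x # s)"
      using cover_path_distinct[OF s(1)] .
    with s rk_path[OF s(1)] show ?thesis
      using distinct_card by fastforce
  qed
  obtain s where "cover_path P x s z" using ex_path assms(1) z by blast
  then have mx: "is_maxchain (ival P x z) (set (x # s))" using cover_path_maxchain by blast
  show ?thesis
    unfolding prank_def[of "ival P x y"] eq
  proof (rule the_equality)
    fix r assume "\<forall>C. is_maxchain (ival P x z) C \<longrightarrow> card C = Suc r"
    with mx card[OF mx] show "r = rk z - rk x" by auto
  qed (use card in blast)
qed

definition dec_paths :: "'a \<Rightarrow> 'a \<Rightarrow> 'a list set" where
  "dec_paths x y = {s. cover_path P x s y \<and> sorted_wrt (>) (elabels x s)}"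

definition inc_paths :: "'a \<Rightarrow> 'a \<Rightarrow> 'a list set" where
  "inc_paths x y = {s. cover_path P x s y \<and> sorted_wrt (\<le>) (elabels x s)}"

lemma finite_dec_paths: "finite (dec_paths x y)" and finite_inc_paths: "finite (inc_paths x y)"
  by (auto simp: dec_paths_def inc_paths_def intro: finite_subset[OF _ finite_paths[of x y]])

lemma card_inc_paths: "x \<in> P \<Longrightarrow> y \<in> P \<Longrightarrow> x \<le> y \<Longrightarrow> card (inc_paths x y) = 1"
  using unique_increasing_path[of x y] unfolding inc_paths_def by (auto simp: card_1_singleton_iff)

lemma finite_ival: "finite (ival P x y)"
  using finite_P by (simp add: ival_def)

lemma length_dec_path: "t \<in> dec_paths x z \<Longrightarrow> length t = rk z - rk x"
  using rk_path by (force simp: dec_paths_def)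

lemma take_edge_labels: "take j (edge_labels lam x s) = edge_labels lam x (take j s)"
  by (induction s arbitrary: x j) (auto simp: take_Cons')

lemma drop_edge_labels: "drop j (edge_labels lam x s) = edge_labels lam (last (x # take j s)) (drop j s)"
  by (induction s arbitrary: x j) (auto simp: drop_Cons' take_Cons')

text \<open>\<open>inc_paths z y\<close> is a singleton by the R-labeling, so completing every
  descending path by the increasing one up to \<open>y\<close> inserts a factor 1. The sum then runs
  over full paths from \<open>x\<close> to \<open>y\<close> with a distinguished cut.\<close>

lemma sum_dec_inc_paths:
  fixes f :: "'a list \<Rightarrow> 'b::comm_semiring_1"
  assumes "x \<in> P" "y \<in> P" "x \<le> y"
  shows "(\<Sum>z\<in>ival P x y. \<Sum>t\<in>dec_paths x z. f t) = (\<Sum>(z, t, u)\<in>Sigma (ival P x y) (\<lambda>z. dec_paths x z \<times> inc_paths z y). f t)"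
proof -
  have "(\<Sum>(z, t, u)\<in>Sigma (ival P x y) (\<lambda>z. dec_paths x z \<times> inc_paths z y). f t)
    = (\<Sum>z\<in>ival P x y. \<Sum>(t, u)\<in>dec_paths x z \<times> inc_paths z y. f t)"
    by (subst sum.Sigma) (auto simp: finite_dec_paths finite_inc_paths finite_ival split_beta)
  also have "\<dots> = (\<Sum>z\<in>ival P x y. \<Sum>t\<in>dec_paths x z. \<Sum>u\<in>inc_paths z y. f t)"
    by (simp only: sum.cartesian_product)
  also have "\<dots> = (\<Sum>z\<in>ival P x y. \<Sum>t\<in>dec_paths x z. f t)"
    using card_inc_paths assms by (intro sum.cong) (auto simp: ival_def)
  finally show ?thesis ..
qed

text \<open>After completion to full paths, the pair \<open>(z, t, u)\<close> is a path
  \<open>t @ u\<close> together with the cut position \<open>length t\<close>. For a fixed path the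
  signs cancel over the cuts unless the path is empty.\<close>

lemma alternating_sum_dec_paths:
  assumes "x \<in> P" "y \<in> P" "x \<le> y"
  shows "(\<Sum>z\<in>ival P x y. (-1) ^ (rk z - rk x) * int (card (dec_paths x z))) = of_bool (x = y)"
proof -
  let ?ok = "\<lambda>s j. sorted_wrt (>) (take j (elabels x s)) \<and> sorted_wrt (\<le>) (drop j (elabels x s))"
  let ?Q = "{s. cover_path P x s y}"
  have "(\<Sum>z\<in>ival P x y. (-1) ^ (rk z - rk x) * int (card (dec_paths x z)))
      = (\<Sum>z\<in>ival P x y. \<Sum>t\<in>dec_paths x z. (-1) ^ length t)"
    by (simp add: length_dec_path mult.commute)
  also have "\<dots> = (\<Sum>(z, t, u)\<in>Sigma (ival P x y) (\<lambda>z. dec_paths x z \<times> inc_paths z y). (-1) ^ length t)"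
    using assms by (rule sum_dec_inc_paths)
  also have "\<dots> = (\<Sum>(s, j)\<in>Sigma ?Q (\<lambda>s. {j. j \<le> length s \<and> ?ok s j}). (-1) ^ j)"
  proof (rule sum.reindex_bij_witness[where
        i = "\<lambda>(s, j). (last (x # take j s), take j s, drop j s)" and
        j = "\<lambda>(z, t, u). (t @ u, length t)"], goal_cases)
    case (1 a)
    then show ?case by (auto simp: dec_paths_def dest: cover_path_last)
  next
    case (2 a)
    then obtain z t u where a: "a = (z, t, u)" and t: "cover_path P x t z" "sorted_wrt (>) (elabels x t)"
      and u: "cover_path P z u y" "sorted_wrt (\<le>) (elabels z u)"
      by (auto simp: dec_paths_def inc_paths_def)
    have "z = last (x # t)" using cover_path_last[OF t(1)] .
    with a t u show ?case
      by (auto simp: edge_labels_append cover_path_append)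
  next
    case (3 b)
    then show ?case by auto
  next
    case (4 b)
    then obtain s j where b: "b = (s, j)" and s: "cover_path P x s y" "j \<le> length s" "?ok s j"
      by auto
    from s(1) obtain z where z: "cover_path P x (take j s) z" "cover_path P z (drop j s) y"
      using cover_path_append[of P x "take j s" "drop j s" y] by auto
    have zl: "z = last (x # take j s)" using cover_path_last[OF z(1)] .
    have "z \<in> ival P x y"
      using cover_path_end[OF z(1)] cover_path_le_end[OF z(1), of x] cover_path_le_end[OF z(2), of z]
      by (auto simp: ival_def)
    with b s z zl show ?case
      by (auto simp: dec_paths_def inc_paths_def take_edge_labels drop_edge_labels)
  qed (auto split: prod.splits)
  also have "\<dots> = (\<Sum>s\<in>?Q. \<Sum>j | j \<le> length s \<and> ?ok s j. (-1) ^ j)"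
    by (subst sum.Sigma) (auto simp: finite_paths)
  also have "\<dots> = (\<Sum>s\<in>?Q. \<Sum>j\<le>length (elabels x s). (-1) ^ j * of_bool (?ok s j))"
    by (intro sum.cong refl sum.mono_neutral_cong_left) auto
  also have "\<dots> = (\<Sum>s\<in>?Q. of_bool (elabels x s = []))"
    by (simp only: alternating_sum_dec_inc)
  also have "\<dots> = (\<Sum>s\<in>?Q. of_bool (s = []))"
    by (simp only: edge_labels_eq_Nil_iff)
  also have "\<dots> = of_bool (x = y)"
  proof -
    have "(\<Sum>s\<in>?Q. of_bool (s = [])) = (if [] \<in> ?Q then 1 else 0 :: int)"
      unfolding of_bool_def by (rule sum.delta[OF finite_paths])
    then show ?thesis using assms by simp
  qed
  finally show ?thesis .
qed

text \<open>The signed numbers of descending paths sum to zero over \<open>[x, z]\<close> unless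
  \<open>x = z\<close>. This is the recursion that defines the Moebius function, so induction on the
  rank identifies the two.\<close>

lemma moebius_ival:
  assumes "x \<in> P" "z \<in> ival P x y"
  shows "moebius (ival P x y) x z = (-1) ^ (rk z - rk x) * int (card (dec_paths x z))"
  using assms(2)
proof (induction "rk z" arbitrary: z rule: less_induct)
  case less
  have z: "z \<in> P" "x \<le> z" "z \<le> y" using less.prems by (auto simp: ival_def)
  have x: "x \<in> ival P x y" using z assms by (auto simp: ival_def)
  show ?case
  proof (cases "x = z")
    case True
    have "dec_paths x x = {[]}"
      using assms by (auto simp: dec_paths_def cover_path_trivial)
    with True x show ?thesis by (simp add: moebius.simps finite_ival)
  next
    case False
    let ?f = "\<lambda>w. (-1) ^ (rk w - rk x) * int (card (dec_paths x w))"
    have "moebius (ival P x y) x z = - (\<Sum>w\<in>{w \<in> ival P x y. x \<le> w \<and> w < z}. moebius (ival P x y) x w)"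
      using False x less.prems z by (subst moebius.simps) (simp add: finite_ival)
    also have "\<dots> = - (\<Sum>w\<in>{w \<in> ival P x y. x \<le> w \<and> w < z}. ?f w)"
      using less.hyps rk_strict_mono z by (intro arg_cong[where f = uminus] sum.cong) (auto simp: ival_def)
    also have "{w \<in> ival P x y. x \<le> w \<and> w < z} = ival P x z - {z}"
      using z by (auto simp: ival_def)
    also have "- sum ?f (ival P x z - {z}) = ?f z - sum ?f (ival P x z)"
      using z finite_ival[of x z] by (subst sum.remove[of _ z ?f]) (auto simp: ival_def)
    also have "sum ?f (ival P x z) = 0"
      using alternating_sum_dec_paths[OF assms(1) z(1,2)] False by simp
    finally show ?thesis by simp
  qed
qed

lemma Poin_ival:
  assumes "x \<in> P" "y \<in> P" "x \<le> y"
  shows "Poin (ival P x y) = (\<Sum>z\<in>ival P x y. \<Sum>t\<in>dec_paths x z. monom 1 (length t))"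
proof -
  have "monom \<bar>moebius (ival P x y) (pbot (ival P x y)) z\<bar> (prank (ival P x y) z)
      = (\<Sum>t\<in>dec_paths x z. monom 1 (length t))" if "z \<in> ival P x y" for z
    using that assms
    by (simp add: pbot_ival prank_ival moebius_ival abs_mult length_dec_path of_nat_monom mult_monom)
  then show ?thesis
    unfolding Poin_def by (intro sum.cong) auto
qed

end

section \<open>Marked maximal chains\<close>

text \<open>The first argument is the edge entering a vertex, the second the edge leaving it, each
  as label and mark. A mark can only continue a marked run, by a strict descent; where a run stops,
  labels are not compared, since there a descending segment meets an independent increasing
  one.\<close>

fun compatible :: "nat \<times> bool \<Rightarrow> nat \<times> bool \<Rightarrow> bool" where
  "compatible (l, b) (l', b') = (if b' then b \<and> l > l' else b \<or> l \<le> l')"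

text \<open>A pair \<open>(b, z)\<close> is the edge ending at \<open>z\<close> with its mark
  \<open>b\<close>. The argument \<open>p\<close> describes the edge entering the start; with
  \<open>None\<close> the start is not tested. The final vertex is never tested.\<close>

fun breaks :: "('a \<Rightarrow> 'a \<Rightarrow> nat) \<Rightarrow> (nat \<times> bool) option \<Rightarrow> 'a \<Rightarrow> (bool \<times> 'a) list \<Rightarrow> 'a set" where
  "breaks lam p x [] = {}"
| "breaks lam p x ((b, z) # s) =
     (case p of None \<Rightarrow> {} | Some e \<Rightarrow> if compatible e (lam x z, b) then {} else {x})
     \<union> breaks lam (Some (lam x z, b)) z s"

definition num_dec :: "(bool \<times> 'a) list \<Rightarrow> nat" where
  "num_dec s = length (filter fst s)"

lemma breaks_None: "breaks lam None x s \<subseteq> breaks lam p x s" "breaks lam p x s \<subseteq> insert x (breaks lam None x s)"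
  by (cases "(lam, p, x, s)" rule: breaks.cases; auto split: option.splits)+

text \<open>\<open>q\<close> is the last edge of \<open>s\<close>, or \<open>p\<close> if
  \<open>s\<close> is empty. It stays anonymous because it influences only the joining vertex, which
  will be an element of \<open>C\<close> and hence exempt.\<close>

lemma breaks_append:
  "\<exists>q. breaks lam p x (s @ t) = breaks lam p x s \<union> breaks lam q (last (x # map snd s)) t"
proof (induction s arbitrary: p x)
  case (Cons e s)
  obtain b z where e: "e = (b, z)" by (cases e)
  obtain q where "breaks lam (Some (lam x z, b)) z (s @ t)
      = breaks lam (Some (lam x z, b)) z s \<union> breaks lam q (last (z # map snd s)) t"
    using Cons.IH by blast
  with e show ?case by (intro exI[of _ q]) (simp add: Un_assoc)
qed auto

lemma breaks_bounds:
  assumes "cover_path P x (map snd s) y" "v \<in> breaks lam p x s"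
  shows "x \<le> v" "v < y" "v \<in> set (x # map snd s)" "p = None \<Longrightarrow> x < v"
proof -
  have "x \<le> v \<and> v < y \<and> v \<in> set (x # map snd s) \<and> (p = None \<longrightarrow> x < v)"
    using assms
  proof (induction s arbitrary: p x)
    case (Cons e s)
    obtain b z where e: "e = (b, z)" by (cases e)
    have xz: "x < z" and path: "cover_path P z (map snd s) y"
      using Cons.prems e by (auto simp: covers_def)
    have zy: "z \<le> y" using cover_path_le_end[OF path] by simp
    consider "v = x" "p \<noteq> None" | "v \<in> breaks lam (Some (lam x z, b)) z s"
      using Cons.prems(2) e by (auto split: option.splits if_splits)
    then show ?case
    proof cases
      case 2
      with Cons.IH[OF path] xz e show ?thesis by fastforce
    qed (use xz zy e in auto)
  qed auto
  then show "x \<le> v" "v < y" "v \<in> set (x # map snd s)" "p = None \<Longrightarrow> x < v" by auto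
qed

section \<open>Shape of the paths without breaks\<close>

lemma ex_Cons_eq_map:
  "(\<exists>t. e # s = map f t \<and> Q t) \<longleftrightarrow> (\<exists>z t. e = f z \<and> s = map f t \<and> Q (z # t))"
  by (auto simp: Cons_eq_map_conv)

text \<open>After an unmarked edge the next marked edge would be a break, so no mark can appear any
  more and only weak increase is left.\<close>

lemma breaks_False_empty_iff:
  "breaks lam (Some (l, False)) x s = {} \<longleftrightarrow>
     (\<exists>t. s = map (Pair False) t \<and> sorted_wrt (\<le>) (l # edge_labels lam x t))"
proof (induction s arbitrary: l x)
  case (Cons e s)
  obtain b z where e: "e = (b, z)" by (cases e)
  show ?case
  proof (cases "b \<or> l > lam x z")
    case True
    then show ?thesis using e by (auto simp: Cons_eq_map_conv)
  next
    case False
    then have "breaks lam (Some (l, False)) x (e # s) = {} \<longleftrightarrow> breaks lam (Some (lam x z, False)) z s = {}"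
      using e by simp
    also have "\<dots> \<longleftrightarrow> (\<exists>t. s = map (Pair False) t \<and> sorted_wrt (\<le>) (lam x z # edge_labels lam z t))"
      by (rule Cons.IH)
    also have "\<dots> \<longleftrightarrow> (\<exists>t. e # s = map (Pair False) t \<and> sorted_wrt (\<le>) (l # edge_labels lam x t))"
      unfolding ex_Cons_eq_map edge_labels.simps sorted2 using False e by auto
    finally show ?thesis .
  qed
qed auto

text \<open>A marked edge may be continued by a descending marked run, which may then be left once
  and for all. The transition from \<open>t\<close> to \<open>u\<close> is free, which is why
  \<open>l\<close> is joined to the labels of \<open>t\<close> only and those of \<open>u\<close>
  are sorted on their own.\<close>

lemma breaks_True_empty_iff:
  "breaks lam (Some (l, True)) x s = {} \<longleftrightarrow>
     (\<exists>t u. s = map (Pair True) t @ map (Pair False) u \<and> sorted_wrt (>) (l # edge_labels lam x t)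
        \<and> sorted_wrt (\<le>) (edge_labels lam (last (x # t)) u))"
proof (induction s arbitrary: l x)
  case (Cons e s)
  obtain b z where e: "e = (b, z)" by (cases e)
  show ?case (is "_ \<longleftrightarrow> ?rhs")
  proof (cases b)
    case True
    have gt: "sorted_wrt (>) (l # m # ys) \<longleftrightarrow> l > m \<and> sorted_wrt (>) (m # ys)" for m and ys :: "nat list"
      by auto
    have "?rhs \<longleftrightarrow> (\<exists>t u. s = map (Pair True) t @ map (Pair False) u \<and> sorted_wrt (>) (l # lam x z # edge_labels lam z t)
        \<and> sorted_wrt (\<le>) (edge_labels lam (last (z # t)) u))"
      (is "_ \<longleftrightarrow> ?rhs'")
    proof
      assume ?rhs
      then obtain t u where tu: "e # s = map (Pair True) t @ map (Pair False) u"
        "sorted_wrt (>) (l # edge_labels lam x t)" "sorted_wrt (\<le>) (edge_labels lam (last (x # t)) u)"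
        by auto
      moreover have "t \<noteq> []"
      proof
        assume "t = []"
        then show False using tu(1) e True by (auto simp: Cons_eq_map_conv)
      qed
      ultimately obtain t' where "t = z # t'" using e by (cases t) auto
      with tu show ?rhs' by (intro exI[of _ t'] exI[of _ u]) auto
    next
      assume ?rhs'
      then obtain t u where "s = map (Pair True) t @ map (Pair False) u"
        "sorted_wrt (>) (l # lam x z # edge_labels lam z t)" "sorted_wrt (\<le>) (edge_labels lam (last (z # t)) u)"
        by auto
      with e True show ?rhs by (intro exI[of _ "z # t"] exI[of _ u]) auto
    qed
    also have "\<dots> \<longleftrightarrow> l > lam x z \<and> breaks lam (Some (lam x z, True)) z s = {}"
      unfolding Cons.IH gt by blast
    also have "\<dots> \<longleftrightarrow> breaks lam (Some (l, True)) x (e # s) = {}"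
      using e True by auto
    finally show ?thesis ..
  next
    case False
    have "?rhs \<longleftrightarrow> (\<exists>u. e # s = map (Pair False) u \<and> sorted_wrt (\<le>) (edge_labels lam x u))"
    proof
      assume ?rhs
      then obtain t u where tu: "e # s = map (Pair True) t @ map (Pair False) u"
        "sorted_wrt (\<le>) (edge_labels lam (last (x # t)) u)"
        by auto
      moreover have "t = []" using tu(1) e False by (cases t) auto
      ultimately show "\<exists>u. e # s = map (Pair False) u \<and> sorted_wrt (\<le>) (edge_labels lam x u)" by auto
    next
      assume "\<exists>u. e # s = map (Pair False) u \<and> sorted_wrt (\<le>) (edge_labels lam x u)"
      then obtain u where "e # s = map (Pair False) u" "sorted_wrt (\<le>) (edge_labels lam x u)"
        by (elim exE conjE)
      then show ?rhs by (intro exI[of _ "[]"] exI[of _ u]) auto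
    qed
    also have "\<dots> \<longleftrightarrow> (\<exists>u. s = map (Pair False) u \<and> sorted_wrt (\<le>) (lam x z # edge_labels lam z u))"
      unfolding ex_Cons_eq_map using e False by auto
    also have "\<dots> \<longleftrightarrow> breaks lam (Some (lam x z, False)) z s = {}"
      by (rule breaks_False_empty_iff[symmetric])
    also have "\<dots> \<longleftrightarrow> breaks lam (Some (l, True)) x (e # s) = {}"
      using e False by auto
    finally show ?thesis ..
  qed
qed auto

text \<open>A virtual first edge with a large label, marked as descending, imposes no constraint.\<close>

lemma breaks_None_empty_iff:
  "breaks lam None x s = {} \<longleftrightarrow>
     (\<exists>t u. s = map (Pair True) t @ map (Pair False) u \<and> sorted_wrt (>) (edge_labels lam x t)
        \<and> sorted_wrt (\<le>) (edge_labels lam (last (x # t)) u))"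
proof -
  define l where "l = Suc (sum_list (edge_labels lam x (map snd s)))"
  have less: "m < l" if "m \<in> set (edge_labels lam x (map snd s))" for m
    using member_le_sum_list[OF that] by (simp add: l_def)
  have "breaks lam None x s = breaks lam (Some (l, True)) x s"
    using less by (cases s) (auto split: if_split_asm)
  also have "\<dots> = {} \<longleftrightarrow> (\<exists>t u. s = map (Pair True) t @ map (Pair False) u \<and> sorted_wrt (>) (edge_labels lam x t)
        \<and> sorted_wrt (\<le>) (edge_labels lam (last (x # t)) u))"
    unfolding breaks_True_empty_iff
    using less by (auto simp: edge_labels_append comp_def)
  finally show ?thesis .
qed

lemma num_dec_append: "num_dec (s @ t) = num_dec s + num_dec t"
  by (simp add: num_dec_def)

lemma num_dec_map_Pair: "num_dec (map (Pair b) t) = (if b then length t else 0)"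
  by (simp add: num_dec_def comp_def)

lemma split_at_vertex:
  "v \<in> set (x # map snd s) \<Longrightarrow> \<exists>t u. s = t @ u \<and> v = last (x # map snd t)"
proof (induction s arbitrary: x)
  case (Cons e s)
  show ?case
  proof (cases "v = x")
    case True
    then show ?thesis by (intro exI[of _ "[]"] exI[of _ "e # s"]) auto
  next
    case False
    with Cons.prems have "v \<in> set (snd e # map snd s)" by auto
    from Cons.IH[OF this] obtain t u where "s = t @ u" "v = last (snd e # map snd t)" by blast
    then show ?thesis by (intro exI[of _ "e # t"] exI[of _ u]) auto
  qed
qed auto

section \<open>Generating functions of marked paths\<close>

context R_labeled_poset
begin

definition unbroken :: "(nat \<times> bool) option \<Rightarrow> 'a \<Rightarrow> 'a \<Rightarrow> (bool \<times> 'a) list set" where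
  "unbroken p x y = {s. cover_path P x (map snd s) y \<and> breaks lam p x s = {}}"

text \<open>The marked chains that contribute to the Poincare polynomial of the chain
  \<open>cs\<close>. The start \<open>x\<close> and the incoming edge \<open>p\<close> are kept
  variable so that the chain can be consumed from below.\<close>

definition through :: "(nat \<times> bool) option \<Rightarrow> 'a \<Rightarrow> 'a list \<Rightarrow> (bool \<times> 'a) list set" where
  "through p x cs = {s. cover_path P x (map snd s) p1 \<and> set cs \<subseteq> set (x # map snd s) \<and> breaks lam p x s \<subseteq> set cs}"

lemma finite_marked_paths: "finite {s :: (bool \<times> 'a) list. cover_path P x (map snd s) y}"
proof (rule finite_subset)
  show "{s :: (bool \<times> 'a) list. cover_path P x (map snd s) y} \<subseteq> {s. set s \<subseteq> UNIV \<times> P \<and> length s = rk y - rk x}"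
    using cover_path_subset rk_path by fastforce
  show "finite {s :: (bool \<times> 'a) list. set s \<subseteq> UNIV \<times> P \<and> length s = rk y - rk x}"
    by (rule finite_lists_length_eq) (simp add: finite_P)
qed

text \<open>An unbroken path splits uniquely where its marks end: a descending path to some
  \<open>z\<close> followed by the one increasing path from \<open>z\<close> to \<open>y\<close>.
  The number of marks is the length of the first part, as in \<open>Poin_ival\<close>.\<close>

lemma sum_unbroken_None:
  assumes "x \<in> P" "y \<in> P" "x \<le> y"
  shows "(\<Sum>s\<in>unbroken None x y. monom 1 (num_dec s)) = Poin (ival P x y)"
proof -
  have tw: "takeWhile fst (map (Pair True) t @ map (Pair False) u) = map (Pair True) t"
    "dropWhile fst (map (Pair True) t @ map (Pair False) u) = map (Pair False) u" for t u :: "'a list"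
    by (induction t) (auto simp: takeWhile_eq_Nil_iff dropWhile_eq_self_iff hd_map)
  note tw = tw tw[of "[]", simplified]
  have "(\<Sum>s\<in>unbroken None x y. monom 1 (num_dec s) :: int poly)
    = (\<Sum>(z, t, u)\<in>Sigma (ival P x y) (\<lambda>z. dec_paths x z \<times> inc_paths z y). monom 1 (length t))"
  proof (rule sum.reindex_bij_witness[where
        j = "\<lambda>s. (last (x # map snd (takeWhile fst s)), map snd (takeWhile fst s), map snd (dropWhile fst s))" and
        i = "\<lambda>(z, t, u). map (Pair True) t @ map (Pair False) u"], goal_cases)
    case (1 s)
    then show ?case
      unfolding unbroken_def breaks_None_empty_iff by (auto simp: tw comp_def)
  next
    case (2 s)
    then obtain t u where s: "s = map (Pair True) t @ map (Pair False) u" "sorted_wrt (>) (elabels x t)"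
      "sorted_wrt (\<le>) (elabels (last (x # t)) u)" and path: "cover_path P x (t @ u) y"
      unfolding unbroken_def breaks_None_empty_iff by (auto simp: comp_def)
    from path obtain z where z: "cover_path P x t z" "cover_path P z u y"
      using cover_path_append by blast
    have zl: "z = last (x # t)" using cover_path_last[OF z(1)] .
    have "z \<in> ival P x y"
      using cover_path_end[OF z(1)] cover_path_le_end[OF z(1), of x] cover_path_le_end[OF z(2), of z]
      by (auto simp: ival_def)
    with s z zl show ?case
      by (auto simp: dec_paths_def inc_paths_def tw comp_def)
  next
    case (3 a)
    then show ?case by (auto simp: tw comp_def dec_paths_def dest: cover_path_last)
  next
    case (4 a)
    then obtain z t u where a: "a = (z, t, u)" and t: "cover_path P x t z" "sorted_wrt (>) (elabels x t)"
      and u: "cover_path P z u y" "sorted_wrt (\<le>) (elabels z u)"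
      by (auto simp: dec_paths_def inc_paths_def)
    have z: "z = last (x # t)" using cover_path_last[OF t(1)] .
    have "breaks lam None x (map (Pair True) t @ map (Pair False) u) = {}"
      unfolding breaks_None_empty_iff using t u z by blast
    moreover have "cover_path P x (t @ u) y"
      using t(1) u(1) by (auto simp: cover_path_append)
    ultimately show ?case
      using a by (simp add: unbroken_def comp_def)
  next
    case (5 s)
    then show ?case
      unfolding unbroken_def breaks_None_empty_iff by (auto simp: tw comp_def num_dec_append num_dec_map_Pair)
  qed
  then show ?thesis
    unfolding Poin_ival[OF assms] sum_dec_inc_paths[OF assms] .
qed

text \<open>The virtual unmarked edge forbids marks, and its label 0 does not restrict the first
  label. What remains is the unique increasing path, without marks.\<close>

lemma sum_unbroken_bot:
  assumes "x \<in> P" "y \<in> P" "x \<le> y"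
  shows "(\<Sum>s\<in>unbroken (Some (0, False)) x y. monom 1 (num_dec s)) = (1 :: int poly)"
proof -
  have "unbroken (Some (0, False)) x y = map (Pair False) ` inc_paths x y"
    unfolding unbroken_def breaks_False_empty_iff inc_paths_def by (auto simp: comp_def)
  moreover have "inj_on (map (Pair False)) (inc_paths x y)"
    by (auto intro: inj_onI dest: map_injective[OF _ injI])
  ultimately show ?thesis
    using card_inc_paths[OF assms] by (simp add: sum.reindex comp_def num_dec_map_Pair monom_0 one_pCons)
qed

section \<open>Factorization along a chain\<close>

fun Poin_list :: "'a list \<Rightarrow> int poly" where
  "Poin_list [] = 1"
| "Poin_list (c # cs) = Poin (ival P c (hd (cs @ [p1]))) * Poin_list cs"

lemma Poin_list_eq_prod:
  "Poin_list cs = (\<Prod>i<length cs. Poin (ival P ((cs @ [p1]) ! i) ((cs @ [p1]) ! Suc i)))"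
proof (induction cs)
  case (Cons c cs)
  then show ?case
    by (simp add: prod.lessThan_Suc_shift hd_conv_nth del: prod.lessThan_Suc)
qed auto

lemma Poin_chain_eq_Poin_list:
  assumes "sorted_wrt (<) cs"
  shows "Poin_chain P (set cs) = Poin_list cs"
proof -
  have "card (set cs) = length cs"
  proof (rule distinct_card)
    show "distinct cs" using assms by (induction cs) auto
  qed
  then show ?thesis
    using assms by (simp add: Poin_chain_def Let_def chain_list_set Poin_list_eq_prod)
qed

text \<open>A break at \<open>c\<close> is permitted, so nothing links the edge entering
  \<open>c\<close> to the edge leaving it: the lower part is unbroken on its own, and the upper part
  restarts with \<open>None\<close>.\<close>

lemma through_Cons:
  assumes "sorted_wrt (<) (c # cs)" "x \<le> c"
  shows "through p x (c # cs) = (\<lambda>(s, t). s @ t) ` (unbroken p x c \<times> through None c cs)"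
proof (intro equalityI subsetI)
  fix s assume s: "s \<in> through p x (c # cs)"
  then have path: "cover_path P x (map snd s) p1" and sub: "set (c # cs) \<subseteq> set (x # map snd s)"
    and br: "breaks lam p x s \<subseteq> set (c # cs)"
    by (auto simp: through_def)
  from sub obtain t u where tu: "s = t @ u" "c = last (x # map snd t)"
    using split_at_vertex[of c x s] by auto
  from path tu(1) obtain z where z: "cover_path P x (map snd t) z" "cover_path P z (map snd u) p1"
    by (auto simp: cover_path_append)
  then have zc: "z = c" using cover_path_last[OF z(1)] tu(2) by simp
  obtain q where q: "breaks lam p x s = breaks lam p x t \<union> breaks lam q c u"
    using breaks_append[of lam p x t u] tu by auto
  have ge: "c \<le> v" if "v \<in> set (c # cs)" for v using assms(1) that by auto
  \<comment> \<open>Breaks of the lower part lie strictly below \<open>c\<close>, whereas all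
    permitted ones are at least \<open>c\<close>.\<close>
  have "breaks lam p x t = {}"
    using breaks_bounds(2)[OF z(1), of _ lam p] br q ge zc by fastforce
  moreover have "breaks lam None c u \<subseteq> set cs"
    using breaks_None(1)[of lam c u q] breaks_bounds(4)[OF z(2), of _ lam None] br q zc by fastforce
  moreover have "v \<in> set (c # map snd u)" if "v \<in> set cs" for v
  proof -
    have "c < v" using that assms(1) by auto
    then have "v \<notin> set (x # map snd t)"
      using cover_path_le_end[OF z(1), of v] zc order.strict_iff_not by blast
    then show ?thesis using that sub tu(1) by auto
  qed
  ultimately show "s \<in> (\<lambda>(s, t). s @ t) ` (unbroken p x c \<times> through None c cs)"
    using z zc tu(1) by (intro image_eqI[of _ _ "(t, u)"]) (auto simp: unbroken_def through_def)
next
  fix s assume "s \<in> (\<lambda>(s, t). s @ t) ` (unbroken p x c \<times> through None c cs)"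
  then obtain t u where s: "s = t @ u" and t: "cover_path P x (map snd t) c" "breaks lam p x t = {}"
    and u: "cover_path P c (map snd u) p1" "set cs \<subseteq> set (c # map snd u)" "breaks lam None c u \<subseteq> set cs"
    by (auto simp: unbroken_def through_def)
  have c: "c = last (x # map snd t)" using cover_path_last[OF t(1)] .
  then have cin: "c \<in> set (x # map snd t)" by (metis last_in_set list.distinct(1))
  obtain q where "breaks lam p x s = breaks lam p x t \<union> breaks lam q c u"
    using breaks_append[of lam p x t u] s c by auto
  then have "breaks lam p x s \<subseteq> set (c # cs)"
    using t(2) u(3) breaks_None(2)[of lam q c u] by auto
  moreover have "set (c # cs) \<subseteq> set (x # map snd s)"
    using cin u(2) s by auto
  moreover have "cover_path P x (map snd s) p1"
    using s t u by (auto simp: cover_path_append)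
  ultimately show "s \<in> through p x (c # cs)"
    by (simp add: through_def)
qed

lemma sum_through:
  assumes "x \<in> P" "sorted_wrt (<) cs" "set cs \<subseteq> P" "\<And>c. c \<in> set cs \<Longrightarrow> x \<le> c"
  shows "(\<Sum>s\<in>through p x cs. monom 1 (num_dec s))
    = (\<Sum>s\<in>unbroken p x (hd (cs @ [p1])). monom 1 (num_dec s)) * Poin_list cs"
  using assms
proof (induction cs arbitrary: p x)
  case Nil
  have "through p x [] = unbroken p x p1" by (auto simp: through_def unbroken_def)
  then show ?case by simp
next
  case (Cons c cs)
  have c: "c \<in> P" "x \<le> c" using Cons.prems by auto
  \<comment> \<open>All paths from \<open>x\<close> to \<open>c\<close> have the same length, the
    difference of ranks, so a concatenation determines its two parts.\<close>
  have inj: "inj_on (\<lambda>(s, t). s @ t) (unbroken p x c \<times> through None c cs)"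
  proof (rule inj_onI, clarify)
    fix s t s' t' assume *: "s \<in> unbroken p x c" "s' \<in> unbroken p x c" "s @ t = s' @ t'"
    then have "length s = length s'"
      using rk_path[of x "map snd s" c] rk_path[of x "map snd s'" c] by (auto simp: unbroken_def)
    with * show "s = s' \<and> t = t'" by auto
  qed
  have le: "\<And>d. d \<in> set cs \<Longrightarrow> c \<le> d" and "sorted_wrt (<) cs"
    using Cons.prems(2) by (auto intro: order.strict_implies_order)
  have next_el: "hd (cs @ [p1]) \<in> P" "c \<le> hd (cs @ [p1])"
    using Cons.prems top by (cases cs; auto)+
  have "(\<Sum>s\<in>through p x (c # cs). monom 1 (num_dec s) :: int poly)
      = (\<Sum>(s, t)\<in>unbroken p x c \<times> through None c cs. monom 1 (num_dec s) * monom 1 (num_dec t))"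
    unfolding through_Cons[OF Cons.prems(2) c(2)] sum.reindex[OF inj]
    by (intro sum.cong) (auto simp: num_dec_append mult_monom)
  also have "\<dots> = (\<Sum>s\<in>unbroken p x c. monom 1 (num_dec s)) * (\<Sum>t\<in>through None c cs. monom 1 (num_dec t))"
    by (simp only: sum_product sum.cartesian_product)
  also have "(\<Sum>t\<in>through None c cs. monom 1 (num_dec t)) = Poin_list (c # cs)"
    using Cons.IH[OF c(1) \<open>sorted_wrt (<) cs\<close> _ le, of None] Cons.prems(3) sum_unbroken_None[OF c(1) next_el] by simp
  finally show ?case by simp
qed

text \<open>\<open>Poin_chain\<close> has no factor for the segment from \<open>p0\<close> to the
  first chain element; accordingly the virtual edge \<open>(0, False)\<close> makes that segment
  contribute 1.\<close>

lemma Poin_chain_eq_sum: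
  assumes "is_chain P C"
  shows "Poin_chain P C = (\<Sum>s | cover_path P p0 (map snd s) p1 \<and> C \<subseteq> set (p0 # map snd s)
    \<and> breaks lam (Some (0, False)) p0 s \<subseteq> C. monom 1 (num_dec s))"
proof -
  have CP: "C \<subseteq> P" using assms by (simp add: is_chain_iff)
  then obtain cs where cs: "sorted_wrt (<) cs" "set cs = C"
    using finite_chain_sorted_list[of C P] assms finite_P finite_subset by blast
  have "hd (cs @ [p1]) \<in> P"
    using cs CP top(1) by (cases cs) auto
  then have "(\<Sum>s\<in>through (Some (0, False)) p0 cs. monom 1 (num_dec s)) = Poin_list cs"
    using sum_through[OF bot(1) cs(1), of "Some (0, False)"] sum_unbroken_bot[OF bot(1)] bot(2) cs(2) CP by auto
  with cs Poin_chain_eq_Poin_list[OF cs(1)] show ?thesis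
    by (simp add: through_def)
qed

end

section \<open>Interlacing sequences of ranks\<close>

lemma mset_set_UN_disjoint:
  assumes "finite I" "\<And>i. i \<in> I \<Longrightarrow> finite (A i)" "\<And>i j. i \<in> I \<Longrightarrow> j \<in> I \<Longrightarrow> i \<noteq> j \<Longrightarrow> A i \<inter> A j = {}"
  shows "mset_set (\<Union>i\<in>I. A i) = (\<Sum>i\<in>I. mset_set (A i))"
  using assms
proof (induction I rule: finite_induct)
  case (insert i I)
  have "A i \<inter> (\<Union>j\<in>I. A j) = {}"
    using insert.hyps(2) insert.prems(2) by (metis (no_types, lifting) Int_UN_distrib SUP_bot_conv(2) insertI1 insertI2)
  with insert show ?case
    by (simp add: mset_set_Union)
qed auto

lemma mset_conv_sum_nth: "mset xs = (\<Sum>i<length xs. {#xs ! i#})"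
  by (induction xs) (auto simp: sum.lessThan_Suc_shift simp del: sum.lessThan_Suc)

lemma sorted_list_locate:
  assumes "sorted_wrt (<) (cs :: 'a::linorder list)"
  obtains i where "i \<le> length cs" "\<And>j. j < i \<Longrightarrow> cs ! j \<le> r" "\<And>j. i \<le> j \<Longrightarrow> j < length cs \<Longrightarrow> r < cs ! j"
proof
  let ?i = "length (takeWhile (\<lambda>c. c \<le> r) cs)"
  show "?i \<le> length cs" by (rule length_takeWhile_le)
  show "cs ! j \<le> r" if "j < ?i" for j
    using that by (metis nth_mem set_takeWhileD takeWhile_nth)
  show "r < cs ! j" if "?i \<le> j" "j < length cs" for j
  proof -
    have "r < cs ! ?i" using that nth_length_takeWhile[of "\<lambda>c. c \<le> r" cs] by force
    also have "\<dots> \<le> cs ! j" using sorted_less_nth_le[OF assms that] .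
    finally show ?thesis .
  qed
qed

text \<open>
  A maximal chain is encoded by the labels \<open>l\<close> of its edges, edge \<open>r\<close> joining the vertices of
  ranks \<open>r\<close> and \<open>r + 1\<close>, and by the set \<open>E\<close> of the edges lying in some interval \<open>[C\<^sub>i, D\<^sub>i]\<close>.
\<close>

definition regular_at :: "(nat \<Rightarrow> nat) \<Rightarrow> nat set \<Rightarrow> nat \<Rightarrow> bool" where
  "regular_at l E r \<longleftrightarrow>
     (if r \<in> E then 0 < r \<and> r - 1 \<in> E \<and> l r < l (r - 1) else r = 0 \<or> r - 1 \<in> E \<or> l (r - 1) \<le> l r)"

text \<open>The ranks of a chain below the top and of a multichain interlacing it. The appended
  \<open>n\<close> is the rank of the top, so that the last entry of \<open>ds\<close> obeys the
  same kind of bound as the others.\<close>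

locale interlacing_ranks =
  fixes n :: nat and cs ds :: "nat list"
  assumes cs_sorted: "sorted_wrt (<) cs"
    and cs_less: "set cs \<subseteq> {..<n}"
    and length_ds: "length ds = length cs"
    and cs_le_ds: "i < length cs \<Longrightarrow> cs ! i \<le> ds ! i"
    and ds_le_cs: "i < length cs \<Longrightarrow> ds ! i \<le> (cs @ [n]) ! Suc i"
begin

definition E :: "nat set" where
  "E = (\<Union>i<length cs. {cs ! i..<ds ! i})"

lemma cs_mono: "i \<le> j \<Longrightarrow> j < length cs \<Longrightarrow> cs ! i \<le> cs ! j"
  using sorted_less_nth_le[OF cs_sorted] .

lemma cs_n_mono: "i \<le> j \<Longrightarrow> j \<le> length cs \<Longrightarrow> (cs @ [n]) ! i \<le> (cs @ [n]) ! j"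
proof (rule sorted_less_nth_le)
  show "sorted_wrt (<) (cs @ [n])"
    using cs_sorted cs_less by (auto simp: sorted_wrt_append)
qed auto

lemma ds_le_cs_later: "i < j \<Longrightarrow> j < length cs \<Longrightarrow> ds ! i \<le> cs ! j"
  using ds_le_cs[of i] cs_mono[of "Suc i" j] by (auto simp: nth_append)

lemma ds_le: "i < length cs \<Longrightarrow> ds ! i \<le> n"
  using ds_le_cs[of i] cs_n_mono[of "Suc i" "length cs"] by auto

lemma ds_sorted: "sorted_wrt (\<le>) ds"
  unfolding sorted_wrt_iff_nth_less
  using ds_le_cs_later cs_le_ds length_ds by (metis order.trans)

lemma ds_subset: "set ds \<subseteq> {..n}"
  using ds_le length_ds by (auto simp: in_set_conv_nth)

lemma E_subset: "E \<subseteq> {..<n}"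
  using ds_le by (force simp: E_def)

lemma not_in_E:
  assumes "i \<le> length cs" "(0 # ds) ! i \<le> q" "q < (cs @ [n]) ! i"
  shows "q \<notin> E"
proof
  assume "q \<in> E"
  then obtain j where j: "j < length cs" "cs ! j \<le> q" "q < ds ! j" by (auto simp: E_def)
  show False
  proof (cases "j < i")
    case True
    then obtain i' where i: "i = Suc i'" "j \<le> i'" by (cases i) auto
    then have "ds ! j \<le> ds ! i'"
      using ds_sorted assms(1) length_ds by (auto intro: sorted_nth_mono)
    with i assms(2) j(3) show False by simp
  next
    case False
    then have "(cs @ [n]) ! i \<le> cs ! j" using cs_mono[of i j] j by (auto simp: nth_append)
    with assms(3) j(2) show False by simp
  qed
qed

text \<open>For each interval, \<open>d\<close> together with \<open>c, ..., d - 1\<close> and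
  \<open>c\<close> together with \<open>c + 1, ..., d\<close> list the same ranks; the sum over all
  intervals is the claim. Keeping terms on both sides avoids truncated multiset subtraction.\<close>

lemma mset_ds: "mset ds + mset_set E = mset_set (set cs) + mset_set (Suc ` E)"
proof -
  have dist: "distinct cs" using cs_sorted by (simp add: strict_sorted_iff)
  have disj: "{cs ! i..<ds ! i} \<inter> {cs ! j..<ds ! j} = {}" "{Suc (cs ! i)..<Suc (ds ! i)} \<inter> {Suc (cs ! j)..<Suc (ds ! j)} = {}"
    if "i < length cs" "j < length cs" "i \<noteq> j" for i j
    using that ds_le_cs_later[of i j] ds_le_cs_later[of j i] by (auto simp: neq_iff)
  have SE: "Suc ` E = (\<Union>i<length cs. {Suc (cs ! i)..<Suc (ds ! i)})"
    by (simp only: E_def image_UN image_Suc_atLeastLessThan)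
  have E': "mset_set (Suc ` E) = (\<Sum>i<length cs. mset_set {Suc (cs ! i)..<Suc (ds ! i)})"
    unfolding SE by (intro mset_set_UN_disjoint disj) auto
  have E: "mset_set E = (\<Sum>i<length cs. mset_set {cs ! i..<ds ! i})"
    unfolding E_def by (intro mset_set_UN_disjoint disj) auto
  have step: "{#d#} + mset_set {c..<d} = {#c#} + mset_set {Suc c..<Suc d}" if "c \<le> d" for c d :: nat
  proof -
    have "{#d#} + mset_set {c..<d} = mset_set (insert d {c..<d})" by simp
    also have "insert d {c..<d} = insert c {Suc c..<Suc d}" using that by auto
    finally show ?thesis by simp
  qed
  have "mset ds + mset_set E = (\<Sum>i<length cs. {#ds ! i#} + mset_set {cs ! i..<ds ! i})"
    unfolding E sum.distrib using mset_conv_sum_nth[of ds] length_ds by simp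
  also have "\<dots> = (\<Sum>i<length cs. {#cs ! i#} + mset_set {Suc (cs ! i)..<Suc (ds ! i)})"
    using step cs_le_ds by (intro sum.cong) auto
  also have "\<dots> = mset_set (set cs) + mset_set (Suc ` E)"
    unfolding E' sum.distrib using mset_conv_sum_nth[of cs] by (simp add: mset_set_set[OF dist])
  finally show ?thesis .
qed

lemma finite_E: "finite E"
  using E_subset finite_subset by blast

text \<open>Sum the entries in \<open>mset_ds\<close>: the shift by \<open>Suc\<close> raises each
  element of \<open>E\<close> by one. This turns \<open>irank\<close> into the number of
  marks.\<close>

lemma sum_list_ds: "sum_list ds = sum_list cs + card E"
proof -
  have "\<Sum>\<^sub># (mset ds + mset_set E) = \<Sum>\<^sub># (mset_set (set cs) + mset_set (Suc ` E))"
    by (simp only: mset_ds)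
  moreover have "\<Sum>\<^sub># (mset_set A) = \<Sum>A" for A :: "nat set"
    using sum_unfold_sum_mset[of "\<lambda>x. x" A] by simp
  moreover have "\<Sum>(Suc ` E) = \<Sum>E + card E"
    using finite_E by (simp add: sum.reindex sum_Suc)
  moreover have "mset_set (set cs) = mset cs"
    using cs_sorted by (simp add: mset_set_set strict_sorted_iff)
  ultimately show ?thesis by (simp add: sum_mset_sum_list)
qed

text \<open>A rank outside \<open>cs\<close> is of one of three kinds. Strictly inside some
  \<open>[c, d]\<close> both adjacent edges are marked and the condition is descent; strictly inside
  a gap both are unmarked and it is weak increase; at an end \<open>d\<close> a marked edge precedes
  an unmarked one and neither side asks anything.\<close>

lemma regular_iff:
  "(\<forall>r<n. r \<notin> set cs \<longrightarrow> regular_at l E r) \<longleftrightarrow>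
     (\<forall>i<length cs. \<forall>r. cs ! i < r \<and> r < ds ! i \<longrightarrow> l r < l (r - 1)) \<and>
     (\<forall>i\<le>length cs. \<forall>r. (0 # ds) ! i < r \<and> r < (cs @ [n]) ! i \<longrightarrow> l (r - 1) \<le> l r)"
  (is "?reg \<longleftrightarrow> ?dec \<and> ?inc")
proof
  assume reg: ?reg
  have notin: "r \<notin> set cs" if r: "i \<le> length cs" "i = 0 \<or> cs ! (i - 1) < r" "r < (cs @ [n]) ! i" for i r
  proof
    assume "r \<in> set cs"
    then obtain j where j: "j < length cs" "r = cs ! j" by (auto simp: in_set_conv_nth)
    show False
    proof (cases "j < i")
      case True
      then have "cs ! j \<le> cs ! (i - 1)" using r(1) by (intro cs_mono) auto
      with r j True show False by auto
    next
      case False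
      then have "(cs @ [n]) ! i \<le> cs ! j" using cs_mono[of i j] j by (auto simp: nth_append)
      with r j show False by simp
    qed
  qed
  have "l r < l (r - 1)" if r: "i < length cs" "cs ! i < r" "r < ds ! i" for i r
  proof -
    have "r \<notin> set cs" using notin[of "Suc i" r] r ds_le_cs[of i] by auto
    moreover have "r < n" using r ds_le[of i] by auto
    moreover have "r \<in> E" using r by (force simp: E_def)
    ultimately show ?thesis using reg by (auto simp: regular_at_def)
  qed
  moreover have "l (r - 1) \<le> l r" if r: "i \<le> length cs" "(0 # ds) ! i < r" "r < (cs @ [n]) ! i" for i r
  proof -
    have "i = 0 \<or> cs ! (i - 1) < r"
      using r cs_le_ds[of "i - 1"] by (cases i) auto
    then have "r \<notin> set cs" using notin r by blast
    moreover have "r \<notin> E" using not_in_E[of i r] r by auto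
    moreover have "r - 1 \<notin> E" using not_in_E[of i "r - 1"] r by auto
    moreover have "r < n" using r cs_n_mono[of i "length cs"] by auto
    ultimately show ?thesis using reg r by (auto simp: regular_at_def)
  qed
  ultimately show "?dec \<and> ?inc" by blast
next
  assume "?dec \<and> ?inc"
  then have dec: ?dec and inc: ?inc by auto
  show ?reg
  proof (intro allI impI)
    fix r assume r: "r < n" "r \<notin> set cs"
    obtain i where i: "i \<le> length cs" "\<And>j. j < i \<Longrightarrow> cs ! j \<le> r" "\<And>j. i \<le> j \<Longrightarrow> j < length cs \<Longrightarrow> r < cs ! j"
      using sorted_list_locate[OF cs_sorted] by metis
    have r_less: "r < (cs @ [n]) ! i" using i(1,3) r(1) by (auto simp: nth_append)
    show "regular_at l E r"
    proof (cases i)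
      case 0
      have "q \<notin> E" if "q \<le> r" for q
        using not_in_E[of 0 q] r_less 0 that by auto
      moreover have "l (r - 1) \<le> l r" if "0 < r"
        using inc[rule_format, of 0 r] r_less 0 that by simp
      ultimately show ?thesis by (auto simp: regular_at_def)
    next
      case (Suc j)
      then have j: "j < length cs" "cs ! j \<noteq> r" "cs ! j \<le> r"
        using i(1,2) r(2) by auto
      consider "r < ds ! j" | "r = ds ! j" | "r > ds ! j" by linarith
      then show ?thesis
      proof cases
        case 1
        then have "r \<in> E" "r - 1 \<in> E" "l r < l (r - 1)"
          using j dec by (force simp: E_def)+
        then show ?thesis using j by (auto simp: regular_at_def)
      next
        case 2
        have "r \<notin> E" using not_in_E[of i r] 2 Suc i(1) r_less by auto
        moreover have "r - 1 \<in> E" using j 2 by (force simp: E_def)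
        ultimately show ?thesis by (auto simp: regular_at_def)
      next
        case 3
        have "r \<notin> E" using not_in_E[of i r] 3 Suc i(1) r_less by auto
        moreover have "l (r - 1) \<le> l r" using inc 3 Suc i(1) r_less by auto
        ultimately show ?thesis by (auto simp: regular_at_def)
      qed
    qed
  qed
qed

end

text \<open>By the last hypothesis a run of \<open>E\<close> can start only at an entry of
  \<open>cs\<close>, so within the stretch from one entry to the next, \<open>E\<close> is an
  initial piece. The corresponding entry of \<open>ds\<close> is where that piece ends.\<close>

lemma ex_interlacing_ranks:
  assumes "sorted_wrt (<) cs" "set cs \<subseteq> {..<n}" "E \<subseteq> {..<n}"
    and step: "\<And>r. r \<in> E \<Longrightarrow> r \<notin> set cs \<Longrightarrow> 0 < r \<and> r - 1 \<in> E"
  obtains ds where "interlacing_ranks n cs ds" "interlacing_ranks.E cs ds = E"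
proof -
  let ?k = "length cs"
  \<comment> \<open>Once outside \<open>E\<close>, a rank walk stays outside until it meets the next
    entry of \<open>cs\<close>.\<close>
  have up: "q \<notin> E" if "d \<le> q" "d \<notin> E" "\<And>r. d < r \<Longrightarrow> r \<le> q \<Longrightarrow> r \<notin> set cs" for d q
    using that
  proof (induction q rule: dec_induct)
    case (step q)
    then show ?case using assms(4)[of "Suc q"] by auto
  qed auto
  have mono: "sorted_wrt (<) (cs @ [n])" using assms by (auto simp: sorted_wrt_append)
  have gap: "r \<notin> set cs" if "i < ?k" "cs ! i < r" "r < (cs @ [n]) ! Suc i" for i r
  proof
    assume "r \<in> set cs"
    then obtain j where j: "j < ?k" "r = cs ! j" by (auto simp: in_set_conv_nth)
    show False
      using that j sorted_less_nth_le[OF assms(1), of j i] sorted_less_nth_le[OF mono, of "Suc i" j]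
      by (cases "j \<le> i") (auto simp: nth_append)
  qed
  have "\<exists>d. cs ! i \<le> d \<and> d \<le> (cs @ [n]) ! Suc i \<and> (\<forall>q. cs ! i \<le> q \<and> q < (cs @ [n]) ! Suc i \<longrightarrow> (q \<in> E \<longleftrightarrow> q < d))"
    if i: "i < ?k" for i
  proof -
    \<comment> \<open>The second alternative stops the search at the next chain rank: when marks
      continue through it, the interval ends there and the next one begins.\<close>
    let ?Q = "\<lambda>q. cs ! i \<le> q \<and> (q \<notin> E \<or> (cs @ [n]) ! Suc i \<le> q)"
    define d where "d = (LEAST q. ?Q q)"
    have "cs ! i \<le> (cs @ [n]) ! Suc i"
      using sorted_less_nth_le[OF mono, of i "Suc i"] i by (auto simp: nth_append)
    then have Q: "?Q ((cs @ [n]) ! Suc i)" by simp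
    have d: "cs ! i \<le> d" "d \<notin> E \<or> (cs @ [n]) ! Suc i \<le> d"
      using LeastI[of ?Q, OF Q] by (simp_all add: d_def)
    have least: "d \<le> q" if "?Q q" for q
      using that unfolding d_def by (rule Least_le)
    have out: "q \<notin> E" if q: "d \<le> q" "q < (cs @ [n]) ! Suc i" for q
    proof (rule up[OF q(1)])
      show "d \<notin> E" using d q by auto
      show "r \<notin> set cs" if "d < r" "r \<le> q" for r
        using gap[OF i, of r] d(1) q that by linarith
    qed
    have "q \<in> E \<longleftrightarrow> q < d" if q: "cs ! i \<le> q" "q < (cs @ [n]) ! Suc i" for q
      using least[of q] q out[of q] by (cases "q < d") auto
    with d(1) least[OF Q] show ?thesis by blast
  qed
  then obtain d where d: "\<And>i. i < ?k \<Longrightarrow> cs ! i \<le> d i" "\<And>i. i < ?k \<Longrightarrow> d i \<le> (cs @ [n]) ! Suc i"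
    "\<And>i q. i < ?k \<Longrightarrow> cs ! i \<le> q \<Longrightarrow> q < (cs @ [n]) ! Suc i \<Longrightarrow> q \<in> E \<longleftrightarrow> q < d i"
    by metis
  define ds where "ds = map d [0..<?k]"
  interpret interlacing_ranks n cs ds
    by unfold_locales (use assms d in \<open>auto simp: ds_def\<close>)
  have "q \<in> interlacing_ranks.E cs ds \<longleftrightarrow> q \<in> E" for q
  proof
    assume "q \<in> interlacing_ranks.E cs ds"
    then obtain i where i: "i < ?k" "cs ! i \<le> q" "q < d i"
      unfolding E_def by (auto simp: ds_def)
    moreover have "q < (cs @ [n]) ! Suc i" using d(2)[of i] i by simp
    ultimately show "q \<in> E" using d(3) by blast
  next
    assume q: "q \<in> E"
    obtain i where i: "i \<le> ?k" "\<And>j. j < i \<Longrightarrow> cs ! j \<le> q" "\<And>j. i \<le> j \<Longrightarrow> j < ?k \<Longrightarrow> q < cs ! j"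
      using sorted_list_locate[OF assms(1)] by metis
    have q_less: "q < (cs @ [n]) ! i" using i(1,3) q assms(3) by (auto simp: nth_append)
    show "q \<in> interlacing_ranks.E cs ds"
    proof (cases i)
      case 0
      \<comment> \<open>Below the first entry there are no marks: \<open>step\<close> excludes 0
        from \<open>E\<close>, and \<open>up\<close> propagates this.\<close>
      have "r \<notin> set cs" if "r \<le> q" for r
        using i(3) 0 that by (force simp: in_set_conv_nth)
      moreover from this have "0 \<notin> E" using step by blast
      ultimately have "q \<notin> E" using up[of 0 q] by auto
      with q show ?thesis by simp
    next
      case (Suc j)
      then have "j < ?k" "cs ! j \<le> q" "q < d j"
        using i q q_less d(3)[of j q] by auto
      then show ?thesis unfolding E_def by (force simp: ds_def)
    qed
  qed
  then show ?thesis
    using that interlacing_ranks_axioms by blast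
qed

section \<open>Marked chains and the sets A and B\<close>

lemma last_Cons_take: "r \<le> length t \<Longrightarrow> last (x # take r t) = (x # t) ! r"
proof (induction t arbitrary: x r)
  case (Cons z t)
  show ?case
  proof (cases r)
    case (Suc m)
    then show ?thesis using Cons.IH[of m z] Cons.prems by simp
  qed auto
qed auto

lemma nth_edge_labels: "r < length t \<Longrightarrow> edge_labels lam x t ! r = lam ((x # t) ! r) ((x # t) ! Suc r)"
  by (induction t arbitrary: x r) (auto simp: nth_Cons')

lemma sorted_wrt_map_upt:
  assumes "transp R"
  shows "sorted_wrt R (map f [a..<b]) \<longleftrightarrow> (\<forall>r. a < r \<and> r < b \<longrightarrow> R (f (r - 1)) (f r))"
proof -
  have "sorted_wrt R (map f [a..<b]) \<longleftrightarrow> (\<forall>i. Suc i < b - a \<longrightarrow> R (f (a + i)) (f (Suc (a + i))))"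
    by (simp add: sorted_wrt_iff_nth_Suc_transp[OF assms])
  also have "\<dots> \<longleftrightarrow> (\<forall>r. a < r \<and> r < b \<longrightarrow> R (f (r - 1)) (f r))"
  proof safe
    fix r assume *: "\<forall>i. Suc i < b - a \<longrightarrow> R (f (a + i)) (f (Suc (a + i)))" "a < r" "r < b"
    from *(1)[rule_format, of "r - a - 1"] *(2,3) show "R (f (r - 1)) (f r)" by simp
  next
    fix i assume *: "\<forall>r. a < r \<and> r < b \<longrightarrow> R (f (r - 1)) (f r)" "Suc i < b - a"
    from *(1)[rule_format, of "Suc (a + i)"] *(2) show "R (f (a + i)) (f (Suc (a + i)))" by simp
  qed
  finally show ?thesis .
qed

text \<open>Prepending \<open>e\<close> shifts the edge list by one: entry \<open>r\<close> of the
  longer list enters vertex \<open>r\<close>, and entry \<open>r\<close> of the shorter one leaves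
  it.\<close>

lemma breaks_eq_image:
  "breaks lam (Some e) x s = nth (x # map snd s) ` {r. r < length s \<and>
     \<not> compatible ((e # zip (edge_labels lam x (map snd s)) (map fst s)) ! r) (zip (edge_labels lam x (map snd s)) (map fst s) ! r)}"
proof (induction s arbitrary: e x)
  case (Cons f s)
  obtain b z where f: "f = (b, z)" by (cases f)
  have split: "{r. r < Suc m \<and> Q r} = (if Q 0 then {0} else {}) \<union> Suc ` {r. r < m \<and> Q (Suc r)}" for m Q
  proof -
    have "r \<in> Suc ` {r. r < m \<and> Q (Suc r)}" if "r < Suc m" "Q r" "r \<noteq> 0" for r
      using that by (cases r) auto
    then show ?thesis by auto
  qed
  show ?case
    unfolding f breaks.simps Cons.IH list.map length_Cons split
    by (auto simp: image_Un image_image)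
qed auto

section \<open>Recovering the marks from multisets of ranks\<close>

definition chain_labels :: "('a \<Rightarrow> 'a \<Rightarrow> nat) \<Rightarrow> 'a list \<Rightarrow> nat \<Rightarrow> nat" where
  "chain_labels lam xs r = lam (xs ! r) (xs ! Suc r)"

definition dec_edges :: "(bool \<times> 'a) list \<Rightarrow> nat set" where
  "dec_edges s = {j. j < length s \<and> fst (s ! j)}"

lemma finite_dec_edges: "finite (dec_edges s)"
  by (simp add: dec_edges_def)

lemma card_dec_edges: "card (dec_edges s) = num_dec s"
  by (simp add: dec_edges_def num_dec_def length_filter_conv_card)

text \<open>The rank multiset of \<open>D\<close>, obtained by solving \<open>mset_ds\<close>. The
  multiset difference is a genuine one only under the inclusion shown in
  \<open>dec_mset_subset\<close>.\<close>

definition dec_mset :: "nat set \<Rightarrow> nat set \<Rightarrow> nat multiset" where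
  "dec_mset S E = mset_set S + mset_set (Suc ` E) - mset_set E"

lemma (in interlacing_ranks) dec_mset_eq: "dec_mset (set cs) E = mset ds"
  unfolding dec_mset_def mset_ds[symmetric] by simp

text \<open>An element of \<open>E\<close> either lies in \<open>S\<close> or continues a run and
  thus lies in \<open>Suc\<close> applied to \<open>E\<close>.\<close>

lemma dec_mset_subset:
  assumes "finite S" "finite E" "\<And>r. r \<in> E \<Longrightarrow> r \<notin> S \<Longrightarrow> 0 < r \<and> r - 1 \<in> E"
  shows "mset_set E \<subseteq># mset_set S + mset_set (Suc ` E)"
proof (rule mset_subset_eqI)
  fix r
  have "r \<in> Suc ` E" if "0 < r" "r - 1 \<in> E"
    using that by (intro image_eqI[of _ _ "r - 1"]) auto
  with assms show "count (mset_set E) r \<le> count (mset_set S + mset_set (Suc ` E)) r"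
    by (auto simp: count_mset_set')
qed

text \<open>Comparing multiplicities at \<open>r\<close> relates membership of \<open>r\<close> to
  membership of \<open>r - 1\<close> only, so \<open>E\<close> is determined from 0 upwards.\<close>

lemma dec_mset_inj:
  assumes fin: "finite E" "finite E'"
    and sub: "mset_set E \<subseteq># mset_set S + mset_set (Suc ` E)" "mset_set E' \<subseteq># mset_set S + mset_set (Suc ` E')"
    and eq: "dec_mset S E = dec_mset S E'"
  shows "E = E'"
proof -
  have "mset_set S + mset_set (Suc ` E) + mset_set E' = mset_set S + mset_set (Suc ` E') + mset_set E"
    using eq sub unfolding dec_mset_def
    by (metis add.assoc add.commute subset_mset.diff_add)
  then have "mset_set (Suc ` E) + mset_set E' = mset_set (Suc ` E') + mset_set E"
    by (simp add: add.assoc)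
  then have *: "count (mset_set (Suc ` E)) r + count (mset_set E') r = count (mset_set (Suc ` E')) r + count (mset_set E) r" for r
    by (metis count_union)
  have "r \<in> E \<longleftrightarrow> r \<in> E'" for r
  proof (induction r)
    case 0
    then show ?case using *[of 0] fin by (auto simp: count_mset_set' split: if_splits)
  next
    case (Suc r)
    then have "Suc r \<in> Suc ` E \<longleftrightarrow> Suc r \<in> Suc ` E'" by auto
    then show ?case using *[of "Suc r"] fin by (auto simp: count_mset_set' split: if_splits)
  qed
  then show ?thesis by blast
qed

section \<open>Triples as marked maximal chains\<close>

context R_labeled_poset
begin

lemma P_eq_ival: "P = ival P p0 p1"
  using bot(2) top(2) by (auto simp: ival_def)

definition marked_chains :: "(bool \<times> 'a) list set" where
  "marked_chains = {s. cover_path P p0 (map snd s) p1}"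

lemma finite_marked_chains: "finite marked_chains"
  unfolding marked_chains_def by (rule finite_marked_paths)

context
  fixes t xs
  assumes path: "cover_path P p0 t p1"
  defines "xs \<equiv> p0 # t"
begin

lemma length_max_path: "length xs = Suc n"
  using length_path_from_bot[OF path] rk_top by (simp add: xs_def)

lemma sorted_max_path: "sorted_wrt (<) xs"
  using cover_path_sorted[OF path] by (simp add: xs_def)

lemma rk_nth: "r \<le> n \<Longrightarrow> rk (xs ! r) = r"
proof -
  assume r: "r \<le> n"
  have len: "length t = n" using length_max_path by (simp add: xs_def)
  from path obtain z where z: "cover_path P p0 (take r t) z"
    using cover_path_append[of P p0 "take r t" "drop r t" p1] by auto
  have "z = xs ! r"
    using cover_path_last[OF z] last_Cons_take[of r t p0] r len by (simp add: xs_def)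
  then show ?thesis
    using length_path_from_bot[OF z] r len by simp
qed

lemma nth_le_iff: "i \<le> n \<Longrightarrow> j \<le> n \<Longrightarrow> xs ! i \<le> xs ! j \<longleftrightarrow> i \<le> j"
  using sorted_less_nth_le[OF sorted_max_path, of i j] sorted_wrt_nth_less[OF sorted_max_path, of j i] length_max_path
  by (cases "i \<le> j") (auto dest: leD)

lemma nth_less_iff: "i \<le> n \<Longrightarrow> j \<le> n \<Longrightarrow> xs ! i < xs ! j \<longleftrightarrow> i < j"
  using nth_le_iff[of i j] nth_le_iff[of j i] by (auto simp: order.strict_iff_not)

lemma inj_nth: "inj_on (nth xs) {..n}"
  by (rule inj_on_inverseI[of _ rk]) (simp add: rk_nth)

lemma set_max_path: "set xs = nth xs ` {..n}"
  using length_max_path by (auto simp: in_set_conv_nth less_Suc_eq_le)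

lemma nth_rk: "x \<in> set xs \<Longrightarrow> xs ! rk x = x"
  by (auto simp: set_max_path rk_nth)

lemma nth_0: "xs ! 0 = p0" and nth_n: "xs ! n = p1"
proof -
  show "xs ! 0 = p0" by (simp add: xs_def)
  have "p1 = last xs" using cover_path_last[OF path] by (simp add: xs_def)
  then show "xs ! n = p1" using length_max_path by (metis diff_Suc_1 last_conv_nth list.size(3) nat.distinct(1))
qed

lemma chain_list_nth:
  assumes "sorted_wrt (<) cs" "set cs \<subseteq> {..n}"
  shows "chain_list (nth xs ` set cs) = map (nth xs) cs"
proof -
  have "sorted_wrt (<) (map (nth xs) cs)"
    unfolding sorted_wrt_map by (rule sorted_wrt_mono_rel[OF _ assms(1)]) (use assms(2) in \<open>auto simp: nth_less_iff\<close>)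
  from chain_list_set[OF this] show ?thesis by simp
qed

lemma mchain_list_nth:
  assumes "sorted_wrt (\<le>) ds" "set ds \<subseteq> {..n}"
  shows "mchain_list (image_mset (nth xs) (mset ds)) = map (nth xs) ds"
proof -
  have "sorted_wrt (\<le>) (map (nth xs) ds)"
    unfolding sorted_wrt_map by (rule sorted_wrt_mono_rel[OF _ assms(1)]) (use assms(2) in \<open>auto simp: nth_le_iff\<close>)
  from mchain_list_mset[OF this] show ?thesis by simp
qed

lemma labels_segment:
  assumes "a \<le> b" "b \<le> n"
  shows "labels lam (set xs \<inter> {xs ! a..xs ! b}) = map (chain_labels lam xs) [a..<b]"
proof -
  have "set [a..<Suc b] = {a..b}"
    by (simp only: set_upt atLeastLessThanSuc_atLeastAtMost)
  then have "set xs \<inter> {xs ! a..xs ! b} = nth xs ` set [a..<Suc b]"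
    using assms by (auto simp: set_max_path nth_le_iff simp del: upt_Suc)
  moreover have "chain_list (nth xs ` set [a..<Suc b]) = map (nth xs) [a..<Suc b]"
    using assms by (intro chain_list_nth) (auto simp del: upt_Suc)
  ultimately have "labels lam (set xs \<inter> {xs ! a..xs ! b})
      = map2 lam (map (nth xs) [a..<Suc b]) (tl (map (nth xs) [a..<Suc b]))"
    by (simp only: labels_def Let_def)
  also have "\<dots> = map (chain_labels lam xs) [a..<b]"
    using assms by (intro nth_equalityI) (auto simp: chain_labels_def nth_tl simp del: upt_Suc)
  finally show ?thesis .
qed

text \<open>Along a fixed maximal chain, \<open>nth xs\<close> is an order isomorphism from
  \<open>{..n}\<close> with inverse \<open>rk\<close>, so every condition of \<open>A_set\<close>
  can be read on ranks; \<open>regular_iff\<close> then merges the segment conditions into the local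
  one.\<close>

lemma A_set_iff:
  assumes cs: "sorted_wrt (<) cs" "set cs \<subseteq> {..<n}" and ds: "sorted_wrt (\<le>) ds" "set ds \<subseteq> {..n}"
  shows "(nth xs ` set cs, image_mset (nth xs) (mset ds), set xs) \<in> A_set P lam l (set cs) \<longleftrightarrow>
    interlacing_ranks n cs ds \<and> sum_list ds = sum_list cs + l \<and>
    (\<forall>r<n. r \<notin> set cs \<longrightarrow> regular_at (chain_labels lam xs) (interlacing_ranks.E cs ds) r)"
proof -
  let ?C = "nth xs ` set cs" and ?D = "image_mset (nth xs) (mset ds)" and ?M = "set xs"
  let ?l = "chain_labels lam xs"
  have csn: "set cs \<subseteq> {..n}" using cs(2) by auto
  have injcs: "inj_on (nth xs) (set cs)" using inj_on_subset[OF inj_nth csn] .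
  have dist: "distinct cs" using cs(1) by (simp add: strict_sorted_iff)
  have clist: "chain_list ?C = map (nth xs) cs" using chain_list_nth[OF cs(1) csn] .
  have dlist: "mchain_list ?D = map (nth xs) ds" using mchain_list_nth[OF ds] .
  have cardC: "card ?C = length cs" using card_image[OF injcs] distinct_card[OF dist] by simp
  have csi: "cs ! i \<le> n" if "i < length cs" for i using csn nth_mem[OF that] by auto
  have dsi: "ds ! i \<le> n" if "i < length ds" for i using ds(2) nth_mem[OF that] by auto
  have mx: "is_maxchain P ?M"
    using cover_path_maxchain[OF path] P_eq_ival by (simp add: xs_def)
  then have chM: "is_chain P ?M" by (simp add: pred_on.maxchain_def)
  have sub: "?C \<subseteq> ?M" "set_mset ?D \<subseteq> ?M"
    using csn ds(2) by (auto simp: set_max_path)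
  have ch: "is_chain P ?C" "is_multichain P ?D"
    using chM sub unfolding is_multichain_def is_chain_iff by blast+
  have rkC: "rk ` ?C = set cs"
    using csn by (force simp: image_image rk_nth)
  have "(\<Sum>X\<in>?C. rk X) = sum_list cs"
    using csn by (simp add: sum.reindex[OF injcs] sum_list_distinct_conv_sum_set[OF dist, of "\<lambda>x. x", simplified])
      (rule sum.cong, auto simp: rk_nth)
  moreover have "(\<Sum>X\<in>#?D. rk X) = sum_list ds"
  proof -
    have "map (\<lambda>r. rk (xs ! r)) ds = ds"
      using ds(2) by (intro map_idI) (auto simp: rk_nth)
    then show ?thesis by (simp add: image_mset.compositionality comp_def sum_mset_sum_list flip: mset_map)
  qed
  ultimately have irank: "irank P ?C ?D = int l \<longleftrightarrow> sum_list ds = sum_list cs + l"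
    unfolding irank_def by auto
  have "interlaces ?D ?C \<longleftrightarrow> length ds = length cs \<and> (\<forall>i<length cs. cs ! i \<le> ds ! i)
      \<and> (\<forall>i. Suc i < length cs \<longrightarrow> ds ! i \<le> cs ! Suc i)"
    unfolding interlaces_def cardC clist dlist using csi dsi
    by (auto simp: nth_le_iff)
  \<comment> \<open>The locale adds the assumptions on \<open>cs\<close>, and for the last index the
    bound \<open>n\<close>, which holds since \<open>set ds\<close> is contained in
    \<open>{..n}\<close>.\<close>
  also have "\<dots> \<longleftrightarrow> interlacing_ranks n cs ds"
    unfolding interlacing_ranks_def using cs dsi by (auto simp: nth_append)
  finally have inter: "interlaces ?D ?C \<longleftrightarrow> interlacing_ranks n cs ds" .
  have incdec: "?M \<in> IncDec P lam ?C ?D \<longleftrightarrow>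
    (\<forall>r<n. r \<notin> set cs \<longrightarrow> regular_at ?l (interlacing_ranks.E cs ds) r)" if "interlacing_ranks n cs ds"
  proof -
    interpret interlacing_ranks n cs ds by (rule that)
    have dec: "decreasing_along lam ?M (chain_list ?C ! i) (mchain_list ?D ! i) \<longleftrightarrow>
        (\<forall>r. cs ! i < r \<and> r < ds ! i \<longrightarrow> ?l r < ?l (r - 1))" if "i < length cs" for i
    proof -
      have "decreasing_along lam ?M (chain_list ?C ! i) (mchain_list ?D ! i)
          \<longleftrightarrow> sorted_wrt (>) (map ?l [cs ! i..<ds ! i])"
        using that cs_le_ds[OF that] ds_le[OF that] length_ds
        by (simp add: decreasing_along_def clist dlist labels_segment)
      then show ?thesis by (simp add: sorted_wrt_map_upt)
    qed
    have inc: "weakly_increasing_along lam ?M ((p0 # mchain_list ?D) ! i) ((chain_list ?C @ [p1]) ! i) \<longleftrightarrow>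
        (\<forall>r. (0 # ds) ! i < r \<and> r < (cs @ [n]) ! i \<longrightarrow> ?l (r - 1) \<le> ?l r)" if "i \<le> length cs" for i
    proof -
      have "p0 # mchain_list ?D = map (nth xs) (0 # ds)" "chain_list ?C @ [p1] = map (nth xs) (cs @ [n])"
        by (simp_all add: dlist clist nth_0 nth_n)
      then have "(p0 # mchain_list ?D) ! i = xs ! ((0 # ds) ! i)" "(chain_list ?C @ [p1]) ! i = xs ! ((cs @ [n]) ! i)"
        using that length_ds by (simp_all only: nth_map length_Cons length_append list.size)
      moreover have "(0 # ds) ! i \<le> (cs @ [n]) ! i"
        using that ds_le_cs by (cases i) auto
      moreover have "(cs @ [n]) ! i \<le> n"
        using cs_n_mono[of i "length cs"] that by simp
      ultimately have "weakly_increasing_along lam ?M ((p0 # mchain_list ?D) ! i) ((chain_list ?C @ [p1]) ! i)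
          \<longleftrightarrow> sorted_wrt (\<le>) (map ?l [(0 # ds) ! i..<(cs @ [n]) ! i])"
        by (simp only: weakly_increasing_along_def labels_segment)
      then show ?thesis by (simp add: sorted_wrt_map_upt)
    qed
    show ?thesis
      unfolding IncDec_def mem_Collect_eq regular_iff cardC using mx sub dec inc by simp
  qed
  show ?thesis
    unfolding A_set_def using ch inter rkC irank incdec by auto
qed

end

text \<open>\<open>C\<close> and \<open>D\<close> lie on \<open>M\<close>, where \<open>rk\<close>
  is injective, so sorting their ranks gives lists from which they can be rebuilt.\<close>

lemma A_set_cases:
  assumes "(C, D, M) \<in> A_set P lam l S" "S \<subseteq> {..<n}"
  obtains t cs ds where "cover_path P p0 t p1" "sorted_wrt (<) cs" "set cs = S"
    "sorted_wrt (\<le>) ds" "set ds \<subseteq> {..n}" "C = nth (p0 # t) ` set cs"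
    "D = image_mset (nth (p0 # t)) (mset ds)" "M = set (p0 # t)"
proof -
  from assms(1) have A: "rk ` C = S" "is_maxchain P M" "C \<subseteq> M" "set_mset D \<subseteq> M"
    by (auto simp: A_set_def IncDec_def)
  from A(2) have "is_maxchain (ival P p0 p1) M" using P_eq_ival by simp
  then obtain t where t: "cover_path P p0 t p1" "M = set (p0 # t)"
    using maxchain_cover_path[OF finite_P bot(1) top(1) bot(2)[OF top(1)]] by metis
  have fin: "finite S" using finite_subset[OF assms(2)] by simp
  let ?cs = "sorted_list_of_set S" and ?ds = "sorted_list_of_multiset (image_mset rk D)"
  have "nth (p0 # t) ` rk ` C = (\<lambda>x. x) ` C"
    unfolding image_image using A(3) t nth_rk[OF t(1)] by (intro image_cong) auto
  then have "C = nth (p0 # t) ` set ?cs"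
    using A(1) fin by simp
  moreover have "image_mset (nth (p0 # t)) (image_mset rk D) = image_mset (\<lambda>x. x) D"
    unfolding multiset.map_comp comp_def
    using A(4) t nth_rk[OF t(1)] by (intro image_mset_cong) blast
  moreover have "set ?ds \<subseteq> {..n}"
  proof
    fix r assume "r \<in> set ?ds"
    then obtain x where x: "x \<in># D" "r = rk x" by auto
    then have "x \<in> P" using A(4) t cover_path_subset[OF t(1)] by blast
    then show "r \<in> {..n}" using rk_mono[OF _ top(1)] top(2) rk_top x by simp
  qed
  ultimately show ?thesis
    using t fin by (intro that[of t ?cs ?ds]) auto
qed

definition admissible :: "nat \<Rightarrow> nat set \<Rightarrow> (bool \<times> 'a) list set" where
  "admissible l S = {s \<in> marked_chains. num_dec s = l \<and>
     (\<forall>r<n. r \<notin> S \<longrightarrow> regular_at (chain_labels lam (p0 # map snd s)) (dec_edges s) r)}"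

text \<open>The inverse of marking: \<open>C\<close> and \<open>D\<close> are rebuilt from
  \<open>S\<close> and the marks. For fixed \<open>s\<close>, varying \<open>S\<close> keeps
  \<open>M\<close> and the marks, which is the effect of \<open>phi\<close>.\<close>

definition triple :: "nat set \<Rightarrow> (bool \<times> 'a) list \<Rightarrow> 'a set \<times> 'a multiset \<times> 'a set" where
  "triple S s = (let xs = p0 # map snd s in
     (nth xs ` S, image_mset (nth xs) (dec_mset S (dec_edges s)), set xs))"

lemma dec_edges_subset: "s \<in> marked_chains \<Longrightarrow> dec_edges s \<subseteq> {..<n}"
  using length_max_path[of "map snd s"] by (auto simp: marked_chains_def dec_edges_def)

lemma admissible_step:
  assumes "s \<in> admissible l S" "r \<in> dec_edges s" "r \<notin> S"
  shows "0 < r \<and> r - 1 \<in> dec_edges s"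
  using assms dec_edges_subset[of s] by (force simp: admissible_def regular_at_def)

lemma admissible_dec_mset_subset:
  "s \<in> admissible l S \<Longrightarrow> finite S \<Longrightarrow> mset_set (dec_edges s) \<subseteq># mset_set S + mset_set (Suc ` dec_edges s)"
  using admissible_step by (intro dec_mset_subset finite_dec_edges) blast+

text \<open>A triple yields the marks \<open>E\<close> of its interlacing ranks; conversely, the
  marks of an admissible chain yield \<open>ds\<close> by \<open>ex_interlacing_ranks\<close>. In
  both directions \<open>dec_mset_eq\<close> says that \<open>D\<close> is the multiset used in
  \<open>triple\<close>.\<close>

lemma A_set_eq_image:
  assumes "S \<subseteq> {..<n}"
  shows "A_set P lam l S = triple S ` admissible l S"
proof (intro equalityI subsetI)
  fix a assume a: "a \<in> A_set P lam l S"
  obtain C D M where CDM: "a = (C, D, M)" by (cases a)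
  obtain t cs ds where t: "cover_path P p0 t p1" and cs: "sorted_wrt (<) cs" "set cs = S"
    and ds: "sorted_wrt (\<le>) ds" "set ds \<subseteq> {..n}"
    and eq: "C = nth (p0 # t) ` set cs" "D = image_mset (nth (p0 # t)) (mset ds)" "M = set (p0 # t)"
    using A_set_cases[OF a[unfolded CDM] assms] .
  have "interlacing_ranks n cs ds" and sum: "sum_list ds = sum_list cs + l"
    and reg: "\<forall>r<n. r \<notin> set cs \<longrightarrow> regular_at (chain_labels lam (p0 # t)) (interlacing_ranks.E cs ds) r"
    using a CDM eq cs assms A_set_iff[OF t cs(1) _ ds, of l] by auto
  then interpret interlacing_ranks n cs ds by simp
  let ?s = "zip (map (\<lambda>j. j \<in> E) [0..<n]) t"
  have len: "length t = n" using length_max_path[OF t] by simp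
  then have ts: "map snd ?s = t" by simp
  have dec: "dec_edges ?s = E"
    using E_subset len by (auto simp: dec_edges_def)
  have "num_dec ?s = l"
    using card_dec_edges[of ?s] dec sum sum_list_ds by simp
  then have "?s \<in> admissible l S"
    using reg t dec ts cs(2) by (simp add: admissible_def marked_chains_def)
  moreover have "a = triple S ?s"
    unfolding triple_def Let_def ts dec CDM eq using dec_mset_eq cs(2) by simp
  ultimately show "a \<in> triple S ` admissible l S" by blast
next
  fix a assume "a \<in> triple S ` admissible l S"
  then obtain s where s: "s \<in> admissible l S" and a: "a = triple S s" by blast
  let ?cs = "sorted_list_of_set S"
  have fin: "finite S" using finite_subset[OF assms] by simp
  then have cs: "sorted_wrt (<) ?cs" "set ?cs = S" by auto
  have t: "cover_path P p0 (map snd s) p1" and mc: "s \<in> marked_chains"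
    using s by (auto simp: admissible_def marked_chains_def)
  obtain ds where ds: "interlacing_ranks n ?cs ds" "interlacing_ranks.E ?cs ds = dec_edges s"
    using ex_interlacing_ranks[of ?cs n "dec_edges s"] cs assms dec_edges_subset[OF mc] admissible_step[OF s]
    by metis
  interpret interlacing_ranks n ?cs ds by (rule ds(1))
  have "sum_list ds = sum_list ?cs + l"
    using sum_list_ds ds(2) card_dec_edges[of s] s by (simp add: admissible_def)
  then have "(nth (p0 # map snd s) ` set ?cs, image_mset (nth (p0 # map snd s)) (mset ds), set (p0 # map snd s))
      \<in> A_set P lam l (set ?cs)"
    using s ds cs assms by (subst A_set_iff[OF t cs(1) _ ds_sorted ds_subset]) (auto simp: admissible_def)
  then show "a \<in> A_set P lam l S"
    using a cs(2) dec_mset_eq ds(2) by (simp add: triple_def Let_def)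
qed

text \<open>\<open>M\<close> determines the path, being a chain with a unique increasing
  enumeration, and the ranks of \<open>D\<close> determine the marks by
  \<open>dec_mset_inj\<close>.\<close>

lemma inj_on_triple:
  assumes "S \<subseteq> {..<n}"
  shows "inj_on (triple S) (admissible l S)"
proof (rule inj_onI)
  fix s s' assume s: "s \<in> admissible l S" "s' \<in> admissible l S" and eq: "triple S s = triple S s'"
  have fin: "finite S" using finite_subset[OF assms] by simp
  have t: "cover_path P p0 (map snd s) p1" "cover_path P p0 (map snd s') p1"
    and mc: "s \<in> marked_chains" "s' \<in> marked_chains"
    using s by (auto simp: admissible_def marked_chains_def)
  have "set (p0 # map snd s) = set (p0 # map snd s')"
    using eq by (simp add: triple_def Let_def)
  then have snds: "map snd s = map snd s'"
    using chain_list_cover_path[OF t(1)] chain_list_cover_path[OF t(2)] by (metis list.inject)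
  let ?xs = "p0 # map snd s"
  have sub: "set_mset (dec_mset S (dec_edges r)) \<subseteq> {..n}" if "r \<in> marked_chains" for r
    using assms fin dec_edges_subset[OF that] finite_dec_edges[of r]
    by (auto simp: dec_mset_def dest!: in_diffD) auto
  have inv: "image_mset rk (image_mset (nth ?xs) (dec_mset S (dec_edges r))) = dec_mset S (dec_edges r)"
    if "r \<in> marked_chains" for r
  proof -
    have "image_mset (\<lambda>x. rk (?xs ! x)) (dec_mset S (dec_edges r)) = image_mset (\<lambda>x. x) (dec_mset S (dec_edges r))"
      using sub[OF that] rk_nth[OF t(1)] by (intro image_mset_cong) blast
    then show ?thesis by (simp add: multiset.map_comp comp_def)
  qed
  have "image_mset (nth ?xs) (dec_mset S (dec_edges s)) = image_mset (nth ?xs) (dec_mset S (dec_edges s'))"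
    using eq snds by (simp add: triple_def Let_def)
  then have "dec_mset S (dec_edges s) = dec_mset S (dec_edges s')"
    using inv[OF mc(1)] inv[OF mc(2)] by metis
  then have E: "dec_edges s = dec_edges s'"
    using dec_mset_inj[OF finite_dec_edges finite_dec_edges] admissible_dec_mset_subset s fin by blast
  have len: "length s = length s'" using snds by (metis length_map)
  show "s = s'"
  proof (rule nth_equalityI[OF len])
    fix i assume i: "i < length s"
    have "fst (s ! i) = fst (s' ! i)" using E i len by (auto simp: dec_edges_def)
    moreover have "snd (s ! i) = snd (s' ! i)" using snds i len by (metis nth_map)
    ultimately show "s ! i = s' ! i" by (rule prod_eqI)
  qed
qed

text \<open>Each new vertex enters both \<open>C\<close> and \<open>D\<close>; it spans a degenerate
  interval without edges, so the marks stay the same.\<close>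

lemma phi_triple:
  assumes "S \<subseteq> T" "T \<subseteq> {..<n}" "s \<in> admissible l S"
  shows "phi S T (triple S s) = triple T s"
proof -
  let ?xs = "p0 # map snd s"
  have fin: "finite S" "finite T"
    using assms(1,2) by (auto intro: finite_subset[of _ "{..<n}"])
  have t: "cover_path P p0 (map snd s) p1"
    using assms(3) by (auto simp: admissible_def marked_chains_def)
  have inj: "inj_on (nth ?xs) (T - S)"
    by (rule inj_on_subset[OF inj_nth[OF t]]) (use assms(2) in auto)
  \<comment> \<open>\<open>W\<close> equals \<open>dec_mset S (dec_edges s)\<close>; writing it as a
    complement lets the multiset difference cancel after \<open>T - S\<close> has been
    added.\<close>
  obtain W where W: "mset_set S + mset_set (Suc ` dec_edges s) = mset_set (dec_edges s) + W"
    using admissible_dec_mset_subset[OF assms(3) fin(1)] by (auto simp: mset_subset_eq_exists_conv)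
  have "mset_set S + mset_set (T - S) + mset_set (Suc ` dec_edges s)
      = (mset_set S + mset_set (Suc ` dec_edges s)) + mset_set (T - S)"
    by (simp only: ac_simps)
  also have "\<dots> = mset_set (dec_edges s) + (W + mset_set (T - S))"
    unfolding W by (rule add.assoc)
  finally have W': "mset_set S + mset_set (T - S) + mset_set (Suc ` dec_edges s)
      = mset_set (dec_edges s) + (W + mset_set (T - S))" .
  have "dec_mset S (dec_edges s) + mset_set (T - S)
      = mset_set S + mset_set (T - S) + mset_set (Suc ` dec_edges s) - mset_set (dec_edges s)"
    unfolding dec_mset_def W W' by simp
  also have "mset_set S + mset_set (T - S) = mset_set T"
    using assms(1) fin by (metis Diff_disjoint Diff_partition finite_Diff mset_set_Union)
  finally have D: "dec_mset T (dec_edges s) = dec_mset S (dec_edges s) + mset_set (T - S)"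
    by (simp add: dec_mset_def)
  have "nth ?xs ` S \<union> nth ?xs ` (T - S) = nth ?xs ` T"
    using assms(1) by blast
  moreover have "image_mset (nth ?xs) (mset_set (T - S)) = mset_set (nth ?xs ` (T - S))"
    using inj by (rule image_mset_mset_set)
  ultimately show ?thesis
    unfolding phi_def triple_def Let_def D using chain_list_cover_path[OF t] by simp
qed

text \<open>All images under \<open>phi\<close> become images of \<open>admissible l S\<close> under
  the single injection \<open>triple T\<close>, so the difference can be taken before applying it. A
  marked chain with \<open>l\<close> marks is admissible for \<open>S\<close> exactly when
  \<open>S\<close> contains its set of irregular ranks; avoiding all proper subsets of
  \<open>T\<close> forces that set to be \<open>T\<close>.\<close>

lemma card_B_set:
  assumes "T \<subseteq> {..<n}"
  shows "card (B_set P lam l T) = card {s \<in> marked_chains. num_dec s = l \<and>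
     {r. r < n \<and> \<not> regular_at (chain_labels lam (p0 # map snd s)) (dec_edges s) r} = T}"
    (is "_ = card ?exact")
proof -
  have adm: "admissible l S \<subseteq> admissible l T" if "S \<subseteq> T" for S
    using that by (auto simp: admissible_def)
  have "phi S T ` A_set P lam l S = triple T ` admissible l S" if "S \<subset> T" for S
    using that assms by (subst A_set_eq_image) (auto simp: image_image phi_triple intro!: image_cong)
  then have "B_set P lam l T = triple T ` admissible l T - (\<Union>S\<in>{S. S \<subset> T}. triple T ` admissible l S)"
    unfolding B_set_def A_set_eq_image[OF assms] by auto
  also have "\<dots> = triple T ` (admissible l T - (\<Union>S\<in>{S. S \<subset> T}. admissible l S))"
    using adm inj_on_triple[OF assms, of l]
    by (subst inj_on_image_set_diff[OF inj_on_triple[OF assms, of l]]) (auto simp: image_UN)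
  also have "admissible l T - (\<Union>S\<in>{S. S \<subset> T}. admissible l S) = ?exact"
  proof (intro equalityI subsetI)
    fix s assume s: "s \<in> admissible l T - (\<Union>S\<in>{S. S \<subset> T}. admissible l S)"
    let ?S = "{r. r < n \<and> \<not> regular_at (chain_labels lam (p0 # map snd s)) (dec_edges s) r}"
    have "?S \<subseteq> T" "s \<in> admissible l ?S" using s by (auto simp: admissible_def)
    with s show "s \<in> ?exact" by (auto simp: admissible_def)
  next
    fix s assume "s \<in> ?exact"
    then show "s \<in> admissible l T - (\<Union>S\<in>{S. S \<subset> T}. admissible l S)"
      by (fastforce simp: admissible_def)
  qed
  also have "card (triple T ` ?exact) = card ?exact"
    by (rule card_image, rule inj_on_subset[OF inj_on_triple[OF assms, of l]]) (auto simp: admissible_def)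
  finally show ?thesis .
qed

text \<open>Away from rank 0, \<open>compatible\<close> and \<open>regular_at\<close> are the same
  test. At rank 0 the virtual edge \<open>(0, False)\<close> rejects a marked first edge and accepts
  any unmarked one, as the clauses of \<open>regular_at\<close> for 0 do.\<close>

lemma breaks_marked_chain:
  assumes "s \<in> marked_chains"
  shows "breaks lam (Some (0, False)) p0 s = nth (p0 # map snd s) `
    {r. r < n \<and> \<not> regular_at (chain_labels lam (p0 # map snd s)) (dec_edges s) r}"
proof -
  let ?z = "zip (edge_labels lam p0 (map snd s)) (map fst s)"
  have t: "cover_path P p0 (map snd s) p1"
    using assms by (auto simp: marked_chains_def)
  then have len: "length s = n" using length_max_path[OF t] by simp
  have z: "?z ! r = (chain_labels lam (p0 # map snd s) r, r \<in> dec_edges s)" if "r < n" for r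
    using that len by (simp add: nth_edge_labels chain_labels_def dec_edges_def)
  have "compatible (((0, False) # ?z) ! r) (?z ! r)
      \<longleftrightarrow> regular_at (chain_labels lam (p0 # map snd s)) (dec_edges s) r" if "r < n" for r
    using that z[of r] z[of "r - 1"] by (cases r) (auto simp: regular_at_def)
  then show ?thesis
    unfolding breaks_eq_image len by (intro arg_cong[where f = "image _"]) auto
qed

end

section \<open>Coefficients of the extended ab-index\<close>

lemma alternating_sum_Pow:
  "finite W \<Longrightarrow> (\<Sum>U\<in>Pow W. (-1) ^ card U) = (of_bool (W = {}) :: int)"
proof (induction W rule: finite_induct)
  case (insert x W)
  have inj: "inj_on (insert x) (Pow W)"
    using insert.hyps(2) by (auto simp: inj_on_def)
  have "(\<Sum>U\<in>insert x ` Pow W. (-1) ^ card U) = (\<Sum>U\<in>Pow W. - ((-1) ^ card U) :: int)"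
    unfolding sum.reindex[OF inj] comp_def
  proof (rule sum.cong)
    fix U assume "U \<in> Pow W"
    then have "finite U" "x \<notin> U" using insert.hyps finite_subset by auto
    then show "(-1) ^ card (insert x U) = (- ((-1) ^ card U) :: int)" by simp
  qed simp
  moreover have "Pow W \<inter> insert x ` Pow W = {}"
    using insert.hyps(2) by auto
  ultimately show ?case
    using insert.hyps(1) unfolding Pow_insert by (simp add: sum.union_disjoint sum_negf)
qed auto

lemma alternating_sum_between:
  assumes "finite T"
  shows "(\<Sum>S | A \<subseteq> S \<and> S \<subseteq> T. (-1) ^ card (T - S)) = (of_bool (A = T) :: int)"
proof (cases "A \<subseteq> T")
  case True
  have "(\<Sum>S | A \<subseteq> S \<and> S \<subseteq> T. (-1) ^ card (T - S)) = (\<Sum>U\<in>Pow (T - A). (-1) ^ card U :: int)"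
    by (rule sum.reindex_bij_witness[where i = "\<lambda>U. T - U" and j = "\<lambda>S. T - S"]) (use True in auto)
  also have "\<dots> = of_bool (T - A = {})"
    using assms by (intro alternating_sum_Pow) auto
  finally show ?thesis using True by auto
next
  case False
  then have empty: "{S. A \<subseteq> S \<and> S \<subseteq> T} = {}" "A \<noteq> T" by auto
  show ?thesis unfolding empty(1) using empty(2) by simp
qed

section \<open>Coefficient extraction in the monoid algebra of words\<close>

lemma lookup_single_times:
  fixes p :: "'a::monoid_add \<Rightarrow>\<^sub>0 'b::comm_ring_1"
  shows "Poly_Mapping.lookup (Poly_Mapping.single u q * p) w
    = (\<Sum>k\<in>Poly_Mapping.keys p. q * Poly_Mapping.lookup p k when u + k = w)"
proof -
  have "(\<Sum>k\<in>Poly_Mapping.keys p. Poly_Mapping.single k (Poly_Mapping.lookup p k)) = p"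
  proof (rule poly_mapping_eqI)
    fix v
    have "(\<Sum>k\<in>Poly_Mapping.keys p. Poly_Mapping.lookup p k when k = v) = Poly_Mapping.lookup p v"
      by (simp add: when_def sum.delta in_keys_iff)
    then show "Poly_Mapping.lookup (\<Sum>k\<in>Poly_Mapping.keys p. Poly_Mapping.single k (Poly_Mapping.lookup p k)) v
        = Poly_Mapping.lookup p v"
      by (simp add: lookup_sum lookup_single)
  qed
  then have "Poly_Mapping.single u q * p
      = Poly_Mapping.single u q * (\<Sum>k\<in>Poly_Mapping.keys p. Poly_Mapping.single k (Poly_Mapping.lookup p k))"
    by simp
  also have "\<dots> = (\<Sum>k\<in>Poly_Mapping.keys p. Poly_Mapping.single (u + k) (q * Poly_Mapping.lookup p k))"
    by (simp add: sum_distrib_left Poly_Mapping.mult_single)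
  finally show ?thesis
    by (simp add: lookup_sum lookup_single)
qed

lemma lookup_letter_times:
  fixes p :: ab_poly
  shows "Poly_Mapping.lookup (Poly_Mapping.single (Word [c]) 1 * p) (Word (d # w))
    = (if d = c then Poly_Mapping.lookup p (Word w) else 0)"
proof -
  have "Word [c] + k = Word (d # w) \<longleftrightarrow> d = c \<and> k = Word w" for k
    by (cases k) auto
  then have "Poly_Mapping.lookup (Poly_Mapping.single (Word [c]) 1 * p) (Word (d # w))
      = (\<Sum>k\<in>Poly_Mapping.keys p. if k = Word w then (if d = c then Poly_Mapping.lookup p k else 0) else 0)"
    unfolding lookup_single_times by (intro sum.cong) (auto simp: when_def)
  then show ?thesis
    by (auto simp: sum.delta in_keys_iff)
qed

lemma lookup_scalar_times: "Poly_Mapping.lookup (scalar q * p) w = q * Poly_Mapping.lookup p w"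
  unfolding scalar_def lookup_single_times
  by (simp add: when_def sum.delta in_keys_iff)

text \<open>In a free monoid, a word of matching length is hit letter by letter, so the coefficient
  is the product of the letter coefficients: 0 or 1 from \<open>var_b\<close>, and 1 or -1 from
  \<open>var_a - var_b\<close>. An arbitrary index list allows induction from the front.\<close>

lemma lookup_prod_list_letters:
  "Poly_Mapping.lookup (prod_list (map (\<lambda>i. if i \<in> S then var_b else var_a - var_b) xs))
     (Word (map (\<lambda>i. if i \<in> T then Letter_b else Letter_a) xs))
   = prod_list (map (\<lambda>i. if i \<in> S then of_bool (i \<in> T) else if i \<in> T then - 1 else 1) xs)"
proof (induction xs)
  case Nil
  then show ?case by (simp flip: zero_word_def)
next
  case (Cons i xs)
  then show ?case
    by (auto simp: var_a_def var_b_def lookup_letter_times left_diff_distrib lookup_minus)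
qed

lemma lookup_wt:
  assumes "T \<subseteq> {..<n}" "S \<subseteq> {..<n}"
  shows "Poly_Mapping.lookup (prod_list (map (\<lambda>i. if i \<in> S then var_b else var_a - var_b) [0..<n])) (u_word n T)
    = (if S \<subseteq> T then (- 1) ^ card (T - S) else 0)"
proof -
  let ?f = "\<lambda>i. if i \<in> S then of_bool (i \<in> T) else if i \<in> T then - 1 else 1 :: int poly"
  have "Poly_Mapping.lookup (prod_list (map (\<lambda>i. if i \<in> S then var_b else var_a - var_b) [0..<n])) (u_word n T)
      = prod ?f {..<n}"
    unfolding u_word_def lookup_prod_list_letters
    by (simp add: prod.distinct_set_conv_list[symmetric] atLeast0LessThan)
  also have "\<dots> = (if S \<subseteq> T then (- 1) ^ card (T - S) else 0)"
  proof (cases "S \<subseteq> T")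
    case True
    have "prod ?f {..<n} = prod (\<lambda>i. - 1) (T - S)"
      using True assms by (intro prod.mono_neutral_cong_right) auto
    then show ?thesis using True by simp
  next
    case False
    then obtain i where "i \<in> S" "i \<notin> T" by blast
    then have "prod ?f {..<n} = 0"
      using assms(2) by (intro prod_zero) auto
    then show ?thesis using False by simp
  qed
  finally show ?thesis .
qed

section \<open>Inclusion-exclusion over chains\<close>

context R_labeled_poset
begin

lemma rk_chain_subset:
  assumes "is_chain (P - {p1}) C"
  shows "rk ` C \<subseteq> {..<n}"
proof
  fix r assume "r \<in> rk ` C"
  then obtain x where x: "x \<in> P" "x \<noteq> p1" "r = rk x"
    using assms by (auto simp: is_chain_iff)
  then have "x < p1" using top(2) by (simp add: order.not_eq_order_implies_strict)
  then show "r \<in> {..<n}" using rk_strict_mono[OF x(1) top(1)] x rk_top by simp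
qed

lemma yw_coeff_exPsi:
  assumes "T \<subseteq> {..<n}"
  shows "yw_coeff (exPsi P) l (u_word n T)
    = (\<Sum>C | is_chain (P - {p1}) C \<and> rk ` C \<subseteq> T. (-1) ^ card (T - rk ` C) * coeff (Poin_chain P C) l)"
proof -
  have fin: "finite {C. is_chain (P - {p1}) C}"
    by (rule finite_subset[of _ "Pow P"]) (auto simp: is_chain_iff finite_P)
  have "yw_coeff (exPsi P) l (u_word n T)
      = (\<Sum>C | is_chain (P - {p1}) C. coeff (Poin_chain P C * Poly_Mapping.lookup (wt P C) (u_word n T)) l)"
    by (simp add: yw_coeff_def exPsi_def lookup_sum lookup_scalar_times coeff_sum)
  also have "\<dots> = (\<Sum>C | is_chain (P - {p1}) C.
      if rk ` C \<subseteq> T then (-1) ^ card (T - rk ` C) * coeff (Poin_chain P C) l else 0)"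
  proof (rule sum.cong)
    fix C assume "C \<in> {C. is_chain (P - {p1}) C}"
    then have "Poly_Mapping.lookup (wt P C) (u_word n T)
        = (if rk ` C \<subseteq> T then (- 1) ^ card (T - rk ` C) else 0)"
      unfolding wt_def rk_top using assms rk_chain_subset by (intro lookup_wt) auto
    moreover have "coeff (p * (- 1) ^ k) l = (- 1) ^ k * coeff p l" for p :: "int poly" and k
      by (cases "even k") auto
    ultimately show "coeff (Poin_chain P C * Poly_Mapping.lookup (wt P C) (u_word n T)) l
        = (if rk ` C \<subseteq> T then (-1) ^ card (T - rk ` C) * coeff (Poin_chain P C) l else 0)"
      by simp
  qed simp
  also have "\<dots> = (\<Sum>C | is_chain (P - {p1}) C \<and> rk ` C \<subseteq> T. (-1) ^ card (T - rk ` C) * coeff (Poin_chain P C) l)"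
    using sum.inter_filter[OF fin, symmetric] by simp
  finally show ?thesis .
qed

text \<open>On a fixed maximal chain a subset \<open>C\<close> is the same as its rank set
  \<open>S\<close>, and the conditions say that \<open>S\<close> lies between the irregular ranks
  and \<open>T\<close>. The alternating sum over this Boolean interval vanishes unless its ends
  agree.\<close>

lemma alternating_sum_chains:
  assumes "T \<subseteq> {..<n}" "s \<in> marked_chains"
  defines "xs \<equiv> p0 # map snd s"
  shows "(\<Sum>C | is_chain (P - {p1}) C \<and> rk ` C \<subseteq> T \<and> C \<subseteq> set xs \<and> breaks lam (Some (0, False)) p0 s \<subseteq> C.
      (-1) ^ card (T - rk ` C))
    = (of_bool ({r. r < n \<and> \<not> regular_at (chain_labels lam xs) (dec_edges s) r} = T) :: int)"
proof -
  let ?bad = "{r. r < n \<and> \<not> regular_at (chain_labels lam xs) (dec_edges s) r}"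
  have t: "cover_path P p0 (map snd s) p1"
    using assms(2) by (simp add: marked_chains_def)
  note rk_nth = rk_nth[OF t, folded xs_def] and nth_rk = nth_rk[OF t, folded xs_def]
    and set_xs = set_max_path[OF t, folded xs_def]
  have br: "breaks lam (Some (0, False)) p0 s = nth xs ` ?bad"
    using breaks_marked_chain[OF assms(2)] by (simp add: xs_def)
  have rk_image: "rk ` nth xs ` S = S" if "S \<subseteq> {..n}" for S
  proof -
    have "rk ` nth xs ` S = (\<lambda>r. r) ` S"
      unfolding image_image using that rk_nth by (intro image_cong) auto
    then show ?thesis by simp
  qed
  have chain: "is_chain P (set xs)"
    using cover_path_chain[OF t] P_eq_ival by (simp add: xs_def)
  have "(\<Sum>C | is_chain (P - {p1}) C \<and> rk ` C \<subseteq> T \<and> C \<subseteq> set xs \<and> breaks lam (Some (0, False)) p0 s \<subseteq> C.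
      (-1) ^ card (T - rk ` C)) = (\<Sum>S | ?bad \<subseteq> S \<and> S \<subseteq> T. (-1) ^ card (T - S) :: int)"
  proof (rule sum.reindex_bij_witness[where i = "\<lambda>S. nth xs ` S" and j = "\<lambda>C. rk ` C"], goal_cases)
    case (1 C)
    then have "nth xs ` rk ` C = (\<lambda>x. x) ` C"
      unfolding image_image using nth_rk by (intro image_cong) auto
    then show ?case by simp
  next
    case (2 C)
    then have "rk ` nth xs ` ?bad \<subseteq> rk ` C" unfolding br by blast
    moreover have "rk ` nth xs ` ?bad = ?bad" by (rule rk_image) auto
    ultimately show ?case using 2 by simp
  next
    case (3 S)
    then have "S \<subseteq> {..n}" using assms(1) by auto
    then show ?case by (rule rk_image)
  next
    case (4 S)
    then have S: "S \<subseteq> {..<n}" "?bad \<subseteq> S" "S \<subseteq> T" using assms(1) by auto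
    then have Sn: "S \<subseteq> {..n}" by auto
    \<comment> \<open>Ranks in \<open>T\<close> are below \<open>n\<close>, so the top element is
      avoided automatically.\<close>
    have "xs ! r \<noteq> p1" if "r \<in> S" for r
      using that S rk_nth[of r] rk_top by auto
    moreover have sub: "nth xs ` S \<subseteq> set xs" using Sn set_xs by auto
    ultimately have "nth xs ` S \<subseteq> P - {p1}"
      using chain by (auto simp: is_chain_iff)
    then have "is_chain (P - {p1}) (nth xs ` S)"
      using chain subsetD[OF sub] unfolding is_chain_iff by simp
    then show ?case
      using sub S(2,3) rk_image[OF Sn] br by auto
  qed simp
  also have "\<dots> = of_bool (?bad = T)"
    using finite_subset[OF assms(1)] by (intro alternating_sum_between) auto
  finally show ?thesis .
qed

lemma yw_coeff_exPsi_eq_card_B_set: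
  assumes "T \<subseteq> {..<n}"
  shows "yw_coeff (exPsi P) l (u_word n T) = int (card (B_set P lam l T))"
proof -
  let ?CC = "{C. is_chain (P - {p1}) C \<and> rk ` C \<subseteq> T}"
  let ?MC = "{s \<in> marked_chains. num_dec s = l}"
  let ?R = "\<lambda>C s. C \<subseteq> set (p0 # map snd s) \<and> breaks lam (Some (0, False)) p0 s \<subseteq> C"
  let ?bad = "\<lambda>s. {r. r < n \<and> \<not> regular_at (chain_labels lam (p0 # map snd s)) (dec_edges s) r}"
  have finC: "finite ?CC"
    by (rule finite_subset[of _ "Pow P"]) (auto simp: is_chain_iff finite_P)
  have finM: "finite ?MC" using finite_marked_chains by simp
  have coeff: "coeff (Poin_chain P C) l = (\<Sum>s | s \<in> ?MC \<and> ?R C s. 1)" if "is_chain (P - {p1}) C" for C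
  proof -
    have "is_chain P C" using that by (auto simp: is_chain_iff)
    then have "coeff (Poin_chain P C) l = (\<Sum>s | s \<in> marked_chains \<and> ?R C s. if num_dec s = l then 1 else 0)"
      by (simp add: Poin_chain_eq_sum coeff_sum marked_chains_def)
    also have "\<dots> = (\<Sum>s | s \<in> {s. s \<in> marked_chains \<and> ?R C s} \<and> num_dec s = l. 1)"
      by (rule sum.inter_filter[symmetric]) (use finite_marked_chains in simp)
    also have "{s. s \<in> {s. s \<in> marked_chains \<and> ?R C s} \<and> num_dec s = l} = {s. s \<in> ?MC \<and> ?R C s}"
      by auto
    finally show ?thesis .
  qed
  have "yw_coeff (exPsi P) l (u_word n T)
      = (\<Sum>C\<in>?CC. \<Sum>s | s \<in> ?MC \<and> ?R C s. (-1) ^ card (T - rk ` C))"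
    unfolding yw_coeff_exPsi[OF assms] using coeff
    by (intro sum.cong) (auto simp: mult.commute)
  \<comment> \<open>With the marked chain \<open>s\<close> fixed first, the inner sum over
    \<open>C\<close> is the one evaluated in \<open>alternating_sum_chains\<close>.\<close>
  also have "\<dots> = (\<Sum>s\<in>?MC. \<Sum>C | C \<in> ?CC \<and> ?R C s. (-1) ^ card (T - rk ` C))"
    by (rule sum.swap_restrict[OF finC finM])
  also have "\<dots> = (\<Sum>s\<in>?MC. of_bool (?bad s = T))"
    using alternating_sum_chains[OF assms] by (intro sum.cong) (auto simp: conj_assoc)
  also have "\<dots> = int (card {s \<in> ?MC. ?bad s = T})"
    using finM by (simp add: of_bool_def sum.If_cases Int_def)
  also have "{s \<in> ?MC. ?bad s = T} = {s \<in> marked_chains. num_dec s = l \<and> ?bad s = T}"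
    by auto
  finally show ?thesis
    unfolding card_B_set[OF assms] .
qed

end

theorem theorem3p6:
  fixes P :: "'a::order set"
    and lam :: "'a \<Rightarrow> 'a \<Rightarrow> nat"
    and n l :: nat
    and T :: "nat set"
  assumes "graded_poset P n"
    and "R_labeling P lam"
    and "T \<subseteq> {0..<n}"
  shows "yw_coeff (exPsi P) l (u_word n T) = int (card (B_set P lam l T))"
proof -
  interpret R_labeled_poset P n lam
    using assms(1,2) by unfold_locales
  show ?thesis
    using yw_coeff_exPsi_eq_card_B_set assms(3) by (simp add: atLeast0LessThan)
qed

end
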